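(* Let $(E,T,S,e)$ be a conditional expectation preserving system and let $q\in[1,\infty)$. Then $L^{q}(T)$ is $S$-invariant, i.e. $S(L^q(T))\subseteq L^q(T)$. Moreover $$\|Sx\|_{T,q}=\|x\|_{T,q}\quad\text{for all }x\in L^{q}(T).$$
   Context: A conditional Riesz triple $(E,e,T)$ consists of a Dedekind complete Riesz space $E$, a weak order unit $e$ of $E$, and a conditional expectation operator $T$ on $E$, that is, a strictly positive order continuous linear projection $T:E\to E$ with $Te=e$ and Dedekind complete range $R(T)$. A conditional expectation preserving system is a 4-tuple $(E,T,S,e)$ where $(E,e,T)$ is a conditional Riesz triple and $S:E\to E$ is an order continuous Riesz (lattice) homomorphism with $Se=e$ and $TSf=Tf$ for all $f\in E$. Let $E^u$ be the universal completion of $E$, equipped with its $f$-algebra structure with multiplicative unit $e$. The natural domain of $T$ is $L^1(T)=D-D\subseteq E^u$, where $D$ is the set of $x\in E^u_+$ for which there is a net $(x_\alpha)$ in $E_+$ with $0\le x_\alpha\uparrow x$ and $(Tx_\alpha)$ order bounded in $E^u$. The operator $T$ is extended to $L^1(T)$ by $Tx=\sup_\alpha Tx_\alpha$ for $x\in D$ with $(x_\alpha)$ such a net, and by linearity; this extension, again denoted $T$, is a conditional expectation operator on $L^1(T)$. The map $S$ has a unique extension to an order continuous Riesz homomorphism $L^1(T)\to L^1(T)$, again denoted $S$, given by $Sx=\sup_\alpha Sx_\alpha$ whenever $x_\alpha\in E_+$ and $x_\alpha\uparrow x\in L^1(T)_+$; it satisfies $TS=T$ on $L^1(T)$. For $q\in[1,\infty)$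 and $x\in E^u_+$, the powers $x^q$ and $x^{1/q}$ are defined by functional calculus in $E^u$ (with $e$ playing the role of the constant function $1$). Then $L^q(T)=\{x\in L^1(T): |x|^q\in L^1(T)\}$ and $\|x\|_{T,q}=(T|x|^q)^{1/q}$ for $x\in L^q(T)$. *)

theory Defs
  imports "HOL-Analysis.Analysis" "HOL-Library.Lattice_Algebras"
begin

section \<open>Riesz spaces\<close>

text \<open>In \<open>lattice_ab_group_add_abs\<close> the modulus is \<open>\<bar>x\<bar> = sup x (- x)\<close>, and \<open>pprt x = sup x 0\<close>.\<close>

class riesz_space = ordered_real_vector + lattice_ab_group_add_abs

class dedekind_complete_riesz_space = riesz_space + conditionally_complete_lattice

definition riesz_hom :: "('a::riesz_space \<Rightarrow> 'b::riesz_space) \<Rightarrow> bool" where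
  "riesz_hom F \<longleftrightarrow> linear F \<and> (\<forall>x y. F (sup x y) = sup (F x) (F y))"

definition up_directed :: "'a::order set \<Rightarrow> bool" where
  "up_directed A \<longleftrightarrow> A \<noteq> {} \<and> (\<forall>a\<in>A. \<forall>b\<in>A. \<exists>c\<in>A. a \<le> c \<and> b \<le> c)"

definition down_directed :: "'a::order set \<Rightarrow> bool" where
  "down_directed A \<longleftrightarrow> A \<noteq> {} \<and> (\<forall>a\<in>A. \<forall>b\<in>A. \<exists>c\<in>A. c \<le> a \<and> c \<le> b)"

text \<open>Monotone nets are represented by their ranges, which are directed sets; conversely a
  directed set is a monotone net indexed by itself.\<close>

definition order_continuous ::
  "('a::dedekind_complete_riesz_space \<Rightarrow> 'b::dedekind_complete_riesz_space) \<Rightarrow> bool" where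
  "order_continuous F \<longleftrightarrow>
     (\<forall>A. down_directed A \<and> bdd_below A \<and> Inf A = 0 \<longrightarrow> Inf ((\<lambda>x. \<bar>F x\<bar>) ` A) = 0)"

definition weak_order_unit :: "'a::riesz_space \<Rightarrow> bool" where
  "weak_order_unit e \<longleftrightarrow> 0 \<le> e \<and> (\<forall>x. inf \<bar>x\<bar> e = 0 \<longrightarrow> x = 0)"

text \<open>Dedekind completeness of a subset for the induced order (suprema are taken in the subset).\<close>

definition dedekind_complete_set :: "'a::order set \<Rightarrow> bool" where
  "dedekind_complete_set R \<longleftrightarrow>
     (\<forall>A\<subseteq>R. A \<noteq> {} \<and> (\<exists>u\<in>R. \<forall>a\<in>A. a \<le> u) \<longrightarrow>
        (\<exists>s\<in>R. (\<forall>a\<in>A. a \<le> s) \<and> (\<forall>u\<in>R. (\<forall>a\<in>A. a \<le> u) \<longrightarrow> s \<le> u)))"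

section \<open>Conditional expectation preserving systems\<close>

definition conditional_riesz_triple ::
  "'a::dedekind_complete_riesz_space \<Rightarrow> ('a \<Rightarrow> 'a) \<Rightarrow> bool" where
  "conditional_riesz_triple e T \<longleftrightarrow>
     weak_order_unit e \<and>
     linear T \<and> (\<forall>x>0. 0 < T x) \<and> order_continuous T \<and> (\<forall>x. T (T x) = T x) \<and>
     T e = e \<and> dedekind_complete_set (range T)"

definition conditional_expectation_preserving_system ::
  "('a::dedekind_complete_riesz_space \<Rightarrow> 'a) \<Rightarrow> ('a \<Rightarrow> 'a) \<Rightarrow> 'a \<Rightarrow> bool" where
  "conditional_expectation_preserving_system T S e \<longleftrightarrow>
     conditional_riesz_triple e T \<and>
     riesz_hom S \<and> order_continuous S \<and> S e = e \<and> (\<forall>f. T (S f) = T f)"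

section \<open>Universal completion\<close>

definition laterally_complete :: "'u::riesz_space itself \<Rightarrow> bool" where
  "laterally_complete _ \<longleftrightarrow>
     (\<forall>A::'u set. A \<noteq> {} \<and> (\<forall>a\<in>A. 0 \<le> a) \<and> (\<forall>a\<in>A. \<forall>b\<in>A. a \<noteq> b \<longrightarrow> inf a b = 0) \<longrightarrow>
        (\<exists>s. (\<forall>a\<in>A. a \<le> s) \<and> (\<forall>u. (\<forall>a\<in>A. a \<le> u) \<longrightarrow> s \<le> u)))"

text \<open>\<open>'u\<close>, Dedekind complete by its sort and laterally complete, is a universal completion of
  \<open>'a\<close> via \<open>j\<close>: an isomorphism of \<open>'a\<close> onto an order dense Riesz subspace of \<open>'u\<close>.\<close>

definition universal_completion ::
  "('a::riesz_space \<Rightarrow> 'u::dedekind_complete_riesz_space) \<Rightarrow> bool" where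
  "universal_completion j \<longleftrightarrow>
     laterally_complete TYPE('u) \<and> riesz_hom j \<and> inj j \<and> (\<forall>u>0. \<exists>x>0. j x \<le> u)"

section \<open>Functional calculus\<close>

text \<open>\<open>band_proj v w\<close>, for \<open>v, w \<ge> 0\<close>, is the projection of \<open>w\<close> onto the band generated by \<open>v\<close>.\<close>

definition band_proj ::
  "'u::dedekind_complete_riesz_space \<Rightarrow> 'u \<Rightarrow> 'u" where
  "band_proj v w = (SUP n::nat. inf w (real n *\<^sub>R v))"

text \<open>The Freudenthal spectral system of \<open>x\<close> with respect to the unit \<open>u\<close>; for functions and
  \<open>u = 1\<close> it is the indicator function of \<open>{x < t}\<close>.\<close>

definition spectral_system ::
  "'u::dedekind_complete_riesz_space \<Rightarrow> 'u \<Rightarrow> real \<Rightarrow> 'u" where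
  "spectral_system u x t = band_proj (pprt (t *\<^sub>R u - x)) u"

text \<open>For \<open>x \<ge> 0\<close> and \<open>f\<close> continuous and nonnegative on \<open>[0, \<infinity>)\<close>, \<open>f x\<close> is the spectral integral of
  \<open>f\<close> over \<open>[0, \<infinity>)\<close>, i.e. the supremum of its lower Riemann-Stieltjes sums. The supremum is over
  all finite partitions of bounded subintervals \<open>[t 0, t n)\<close>, so \<open>f\<close> may be unbounded.\<close>

definition lower_sums ::
  "'u::dedekind_complete_riesz_space \<Rightarrow> (real \<Rightarrow> real) \<Rightarrow> 'u \<Rightarrow> 'u set" where
  "lower_sums u f x =
     {\<Sum>i<n. Inf (f ` {t i..<t (Suc i)}) *\<^sub>R
              (spectral_system u x (t (Suc i)) - spectral_system u x (t i)) | (n::nat) t.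
        0 \<le> t 0 \<and> (\<forall>i<n. t i < t (Suc i))}"

definition functional_calculus ::
  "'u::dedekind_complete_riesz_space \<Rightarrow> (real \<Rightarrow> real) \<Rightarrow> 'u \<Rightarrow> 'u" where
  "functional_calculus u f x = Sup (lower_sums u f x)"

definition riesz_powr ::
  "'u::dedekind_complete_riesz_space \<Rightarrow> 'u \<Rightarrow> real \<Rightarrow> 'u" where
  "riesz_powr u x p = functional_calculus u (\<lambda>s. s powr p) x"

section \<open>The natural domain and the extensions of \<open>T\<close> and \<open>S\<close>\<close>

text \<open>In the following, \<open>j\<close> embeds the Riesz space into its universal completion.\<close>

definition increases_to ::
  "('a::riesz_space \<Rightarrow> 'u::dedekind_complete_riesz_space) \<Rightarrow> 'a set \<Rightarrow> 'u \<Rightarrow> bool" where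
  "increases_to j A x \<longleftrightarrow>
     up_directed A \<and> (\<forall>a\<in>A. 0 \<le> a) \<and> bdd_above (j ` A) \<and> Sup (j ` A) = x"

definition natural_cone ::
  "('a::riesz_space \<Rightarrow> 'u::dedekind_complete_riesz_space) \<Rightarrow> ('a \<Rightarrow> 'a) \<Rightarrow> 'u set" where
  "natural_cone j T = {x. 0 \<le> x \<and> (\<exists>A. increases_to j A x \<and> bdd_above (j ` T ` A))}"

definition L1 ::
  "('a::riesz_space \<Rightarrow> 'u::dedekind_complete_riesz_space) \<Rightarrow> ('a \<Rightarrow> 'a) \<Rightarrow> 'u set" where
  "L1 j T = {x - y | x y. x \<in> natural_cone j T \<and> y \<in> natural_cone j T}"

text \<open>The common value of \<open>sup F x\<^sub>\<alpha>\<close> for all increasing nets in the Riesz space with supremum \<open>x\<close>.\<close>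

definition cone_extension ::
  "('a::riesz_space \<Rightarrow> 'u::dedekind_complete_riesz_space) \<Rightarrow> ('a \<Rightarrow> 'a) \<Rightarrow> 'u \<Rightarrow> 'u" where
  "cone_extension j F x =
     (THE y. \<exists>A. increases_to j A x \<and> bdd_above (j ` F ` A) \<and> y = Sup (j ` F ` A))"

text \<open>Extension by linearity from a cone \<open>C\<close> to \<open>C - C\<close> (unspecified outside \<open>C - C\<close>).\<close>

definition linear_extension ::
  "'u::riesz_space set \<Rightarrow> ('u \<Rightarrow> 'u) \<Rightarrow> 'u \<Rightarrow> 'u" where
  "linear_extension C G z = (THE w. \<exists>x\<in>C. \<exists>y\<in>C. z = x - y \<and> w = G x - G y)"

definition extend_T ::
  "('a::riesz_space \<Rightarrow> 'u::dedekind_complete_riesz_space) \<Rightarrow> ('a \<Rightarrow> 'a) \<Rightarrow> 'u \<Rightarrow> 'u" where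
  "extend_T j T = linear_extension (natural_cone j T) (cone_extension j T)"

definition extend_S ::
  "('a::riesz_space \<Rightarrow> 'u::dedekind_complete_riesz_space) \<Rightarrow> ('a \<Rightarrow> 'a) \<Rightarrow> ('a \<Rightarrow> 'a) \<Rightarrow> 'u \<Rightarrow> 'u" where
  "extend_S j T S = linear_extension {x \<in> L1 j T. 0 \<le> x} (cone_extension j S)"

section \<open>The spaces \<open>L\<^sup>q(T)\<close>\<close>

definition Lq ::
  "('a::riesz_space \<Rightarrow> 'u::dedekind_complete_riesz_space) \<Rightarrow> ('a \<Rightarrow> 'a) \<Rightarrow> 'a \<Rightarrow> real \<Rightarrow> 'u set" where
  "Lq j T e q = {x \<in> L1 j T. riesz_powr (j e) \<bar>x\<bar> q \<in> L1 j T}"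

definition Lq_norm ::
  "('a::riesz_space \<Rightarrow> 'u::dedekind_complete_riesz_space) \<Rightarrow> ('a \<Rightarrow> 'a) \<Rightarrow> 'a \<Rightarrow> real \<Rightarrow> 'u \<Rightarrow> 'u" where
  "Lq_norm j T e q x = riesz_powr (j e) (extend_T j T (riesz_powr (j e) \<bar>x\<bar> q)) (1 / q)"

end

theory Submission
  imports Defs
begin

text \<open>For \<open>x \<ge> 0\<close> the set of all \<open>a \<ge> 0\<close> in the Riesz space with \<open>j a \<le> x\<close> is a canonical net
  increasing to \<open>x\<close>; order continuity shows that it computes both extensions. If \<open>T\<close> is bounded on
  the net of \<open>x\<close> then, as \<open>T S = T\<close>, it is bounded on the image of that net under \<open>S\<close>, and strict
  positivity of \<open>T\<close> with lateral completeness bounds the image itself. So \<open>S\<close> extends to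
  \<open>L\<^sup>1(T)\<close>, and \<open>T S = T\<close> persists.

  The extension of \<open>S\<close> commutes with the modulus. It also maps the spectral system of \<open>x\<close> to that of
  \<open>S x\<close>; hence it maps the lower sums of \<open>x\<close> onto those of \<open>S x\<close>, which gives
  \<open>(S x)\<^sup>q = S (x\<^sup>q)\<close>. Therefore \<open>T \<bar>S x\<bar>\<^sup>q = T S \<bar>x\<bar>\<^sup>q = T \<bar>x\<bar>\<^sup>q\<close>.\<close>

section \<open>Suprema in Riesz spaces\<close>

text \<open>Order continuity of \<open>S\<close> is available only inside the original Riesz space,
  while powers and norms live in the universal completion. The bridge is that a Dedekind complete
  space is an ideal in its universal completion: every truncation of a positive element at a
  multiple of \<open>e\<close> comes from the original space, and with it the spectral components
  and the lower sums. The identity for powers thus becomes a statement about suprema of pulled-back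
  sets. The other obstacle is boundedness: \<open>Sup\<close> is meaningful only on bounded sets,
  and a single multiple of \<open>e\<close> need not bound them. Both bounds, for \<open>S\<close>
  on a net and for the lower sums, are obtained band by band: a set bounded by \<open>u m\<close> on
  components \<open>c m\<close> increasing to the unit is bounded, because lateral completeness
  supplies an upper bound for the disjoint pieces. For nets the components come from a Markov
  inequality for \<open>T\<close>, for lower sums from the spectral system.\<close>

declare diff_inf_eq_sup [simp del]
  and diff_sup_eq_inf [simp del]

text \<open>A relation, because \<open>riesz_space\<close> has no \<open>Sup\<close> and the
  \<open>Sup\<close> of an unbounded set is unspecified; a proof of \<open>has_sup\<close> certifies
  that the supremum exists.\<close>

definition has_sup :: "'a::order set \<Rightarrow> 'a \<Rightarrow> bool" where
  "has_sup A s \<longleftrightarrow> A \<noteq> {} \<and> (\<forall>a\<in>A. a \<le> s) \<and> (\<forall>u. (\<forall>a\<in>A. a \<le> u) \<longrightarrow> s \<le> u)"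

lemma has_supI:
  assumes "A \<noteq> {}" "\<And>a. a \<in> A \<Longrightarrow> a \<le> s" "\<And>u. (\<And>a. a \<in> A \<Longrightarrow> a \<le> u) \<Longrightarrow> s \<le> u"
  shows "has_sup A s"
  using assms by (auto simp: has_sup_def)

lemma has_sup_upper: "has_sup A s \<Longrightarrow> a \<in> A \<Longrightarrow> a \<le> s"
  by (auto simp: has_sup_def)

lemma has_sup_least: "has_sup A s \<Longrightarrow> (\<And>a. a \<in> A \<Longrightarrow> a \<le> u) \<Longrightarrow> s \<le> u"
  by (auto simp: has_sup_def)

lemma has_sup_nonempty: "has_sup A s \<Longrightarrow> A \<noteq> {}"
  by (auto simp: has_sup_def)

lemma has_sup_unique: "has_sup A s \<Longrightarrow> has_sup A t \<Longrightarrow> s = t"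
  by (auto simp: has_sup_def intro: antisym)

lemma has_sup_bdd: "has_sup A s \<Longrightarrow> bdd_above A"
  by (auto simp: has_sup_def bdd_above_def)

lemma has_sup_Sup:
  fixes A :: "'a::conditionally_complete_lattice set"
  shows "A \<noteq> {} \<Longrightarrow> bdd_above A \<Longrightarrow> has_sup A (Sup A)"
  by (intro has_supI) (auto intro: cSup_upper cSup_least)

lemma Sup_eq_has_sup:
  fixes A :: "'a::conditionally_complete_lattice set"
  shows "has_sup A s \<Longrightarrow> Sup A = s"
  using has_sup_unique has_sup_Sup has_sup_nonempty has_sup_bdd by metis

text \<open>Infinite distributivity without completeness: \<open>a + x = inf a x + sup a x\<close>
  turns a bound \<open>u\<close> on the infima into the bound \<open>u + sup s x - x\<close> on
  \<open>A\<close>.\<close>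

lemma has_sup_inf:
  fixes A :: "'a::riesz_space set"
  assumes "has_sup A s"
  shows "has_sup ((\<lambda>a. inf a x) ` A) (inf s x)"
proof (rule has_supI)
  show "(\<lambda>a. inf a x) ` A \<noteq> {}" using assms by (simp add: has_sup_def)
  show "b \<le> inf s x" if "b \<in> (\<lambda>a. inf a x) ` A" for b
    using that has_sup_upper[OF assms] by (auto intro: le_infI1)
  fix u assume u: "\<And>b. b \<in> (\<lambda>a. inf a x) ` A \<Longrightarrow> b \<le> u"
  have "s \<le> u + sup s x - x"
  proof (rule has_sup_least[OF assms])
    fix a assume a: "a \<in> A"
    have "a = inf a x + sup a x - x"
      by (metis add.commute add_diff_cancel_right' add_eq_inf_sup)
    also have "\<dots> \<le> u + sup s x - x"
      using u[of "inf a x"] a has_sup_upper[OF assms a]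
      by (intro diff_right_mono add_mono) (auto intro: le_supI1)
    finally show "a \<le> u + sup s x - x" .
  qed
  moreover have "inf s x = s + x - sup s x"
    by (metis add_diff_cancel_right' add.commute add_eq_inf_sup)
  ultimately show "inf s x \<le> u"
    by (metis add.commute diff_le_eq le_diff_eq)
qed

lemma has_sup_plus:
  fixes A B :: "'a::riesz_space set"
  assumes "has_sup A s" "has_sup B t"
  shows "has_sup {a + b | a b. a \<in> A \<and> b \<in> B} (s + t)"
proof (rule has_supI)
  show "{a + b | a b. a \<in> A \<and> b \<in> B} \<noteq> {}"
    using assms by (auto simp: has_sup_def)
  show "c \<le> s + t" if "c \<in> {a + b | a b. a \<in> A \<and> b \<in> B}" for c
    using that has_sup_upper[OF assms(1)] has_sup_upper[OF assms(2)] by (auto intro: add_mono)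
  fix u assume u: "\<And>c. c \<in> {a + b | a b. a \<in> A \<and> b \<in> B} \<Longrightarrow> c \<le> u"
  have "s \<le> u - t"
  proof (rule has_sup_least[OF assms(1)])
    fix a assume a: "a \<in> A"
    have "t \<le> u - a"
    proof (rule has_sup_least[OF assms(2)])
      fix b assume "b \<in> B"
      then have "a + b \<le> u" using a by (intro u) auto
      then show "b \<le> u - a" by (simp add: algebra_simps)
    qed
    then show "a \<le> u - t" by (simp add: algebra_simps)
  qed
  then show "s + t \<le> u" by (simp add: algebra_simps)
qed

lemma has_sup_scaleR:
  fixes A :: "'a::riesz_space set"
  assumes "has_sup A s" "0 < r"
  shows "has_sup ((\<lambda>a. r *\<^sub>R a) ` A) (r *\<^sub>R s)"
proof (rule has_supI)
  show "(\<lambda>a. r *\<^sub>R a) ` A \<noteq> {}" using assms by (simp add: has_sup_def)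
  show "b \<le> r *\<^sub>R s" if "b \<in> (\<lambda>a. r *\<^sub>R a) ` A" for b
    using that has_sup_upper[OF assms(1)] assms(2) by (auto intro: scaleR_left_mono)
  fix u assume u: "\<And>b. b \<in> (\<lambda>a. r *\<^sub>R a) ` A \<Longrightarrow> b \<le> u"
  have "s \<le> inverse r *\<^sub>R u"
  proof (rule has_sup_least[OF assms(1)])
    fix a assume "a \<in> A"
    then have "inverse r *\<^sub>R (r *\<^sub>R a) \<le> inverse r *\<^sub>R u"
      using assms(2) by (intro scaleR_left_mono u) auto
    then show "a \<le> inverse r *\<^sub>R u" using assms(2) by simp
  qed
  then have "r *\<^sub>R s \<le> r *\<^sub>R (inverse r *\<^sub>R u)"
    using assms(2) by (intro scaleR_left_mono) auto
  then show "r *\<^sub>R s \<le> u" using assms(2) by simp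
qed

text \<open>The supremum of the multiples of \<open>x\<close> can absorb one more
  \<open>x\<close>.\<close>

lemma riesz_archimedean:
  fixes x y :: "'a::dedekind_complete_riesz_space"
  assumes "\<And>n::nat. real n *\<^sub>R x \<le> y"
  shows "x \<le> 0"
proof -
  let ?A = "range (\<lambda>n::nat. real n *\<^sub>R x)"
  have hs: "has_sup ?A (Sup ?A)"
    using assms by (intro has_sup_Sup) (auto simp: bdd_above_def)
  have "Sup ?A \<le> Sup ?A - x"
  proof (rule has_sup_least[OF hs])
    fix a assume "a \<in> ?A"
    then obtain n where n: "a = real n *\<^sub>R x" by auto
    have "real (Suc n) *\<^sub>R x \<le> Sup ?A" by (rule has_sup_upper[OF hs]) blast
    then show "a \<le> Sup ?A - x" by (simp add: n algebra_simps)
  qed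
  then show ?thesis by (simp add: algebra_simps)
qed

section \<open>Disjointness and weak order units\<close>

lemma inf_add_le:
  fixes x y z :: "'a::riesz_space"
  assumes "0 \<le> x" "0 \<le> y" "0 \<le> z"
  shows "inf (x + y) z \<le> inf x z + inf y z"
proof -
  \<comment> \<open>Translation invariance expands the sum into an infimum of four sums, each above
    the left-hand side.\<close>
  have "inf x z + inf y z = inf (inf (x + y) (x + z)) (inf (z + y) (z + z))"
    by (simp add: add_inf_distrib_left add_inf_distrib_right inf_aci add.commute)
  moreover have "inf (x + y) z \<le> x + z" "inf (x + y) z \<le> z + y" "inf (x + y) z \<le> z + z"
    using assms by (simp_all add: le_infI2)
  ultimately show ?thesis by simp
qed

lemma inf_scaleR_nat_eq_0:
  fixes x y :: "'a::riesz_space"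
  assumes "0 \<le> x" "0 \<le> y" "inf x y = 0"
  shows "inf x (real n *\<^sub>R y) = 0"
proof (induction n)
  case 0
  then show ?case using assms by (simp add: inf_absorb2)
next
  case (Suc n)
  have "inf (real n *\<^sub>R y + y) x \<le> inf (real n *\<^sub>R y) x + inf y x"
    using assms by (intro inf_add_le) (auto intro: scaleR_nonneg_nonneg)
  also have "\<dots> = 0" using Suc assms by (simp add: inf_commute)
  finally have "inf x (real (Suc n) *\<^sub>R y) \<le> 0" by (simp add: algebra_simps inf_commute)
  moreover have "0 \<le> inf x (real (Suc n) *\<^sub>R y)"
    using assms by (simp add: scaleR_nonneg_nonneg del: of_nat_Suc)
  ultimately show ?case by (rule antisym)
qed

lemma inf_scaleR_eq_0:
  fixes x y :: "'a::riesz_space"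
  assumes "0 \<le> x" "0 \<le> y" "inf x y = 0" "0 \<le> r"
  shows "inf x (r *\<^sub>R y) = 0"
proof -
  obtain n :: nat where "r \<le> real n" using real_arch_simple by blast
  then have "inf x (r *\<^sub>R y) \<le> inf x (real n *\<^sub>R y)"
    using assms by (intro inf_mono scaleR_right_mono) auto
  then show ?thesis
    using inf_scaleR_nat_eq_0[OF assms(1-3)] assms by (intro antisym) (auto simp: scaleR_nonneg_nonneg)
qed

lemma inf_eq_0_mono:
  fixes x y :: "'a::riesz_space"
  assumes "inf x y = 0" "0 \<le> x'" "x' \<le> x" "0 \<le> y'" "y' \<le> y"
  shows "inf x' y' = 0"
proof (rule antisym)
  show "inf x' y' \<le> 0" using inf_mono[OF assms(3,5)] assms(1) by simp
qed (use assms in simp)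

lemma has_sup_inf_eq_0:
  fixes A :: "'a::riesz_space set"
  assumes "has_sup A s" "\<And>a. a \<in> A \<Longrightarrow> inf a x = 0"
  shows "inf s x = 0"
proof -
  have "(\<lambda>a. inf a x) ` A = {0}"
    using assms(2) has_sup_nonempty[OF assms(1)] by (auto simp: image_iff)
  then have "has_sup {0} (inf s x)" using has_sup_inf[OF assms(1), of x] by simp
  then show ?thesis by (rule has_sup_unique) (auto simp: has_sup_def)
qed

lemma add_eq_sup_of_disjoint:
  fixes x y :: "'a::riesz_space"
  shows "inf x y = 0 \<Longrightarrow> x + y = sup x y"
  using add_eq_inf_sup[of x y] by simp

lemma riesz_decomposition:
  fixes a x y :: "'a::riesz_space"
  assumes "0 \<le> a" "a \<le> x + y" "0 \<le> x" "0 \<le> y"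
  obtains u v where "a = u + v" "0 \<le> u" "u \<le> x" "0 \<le> v" "v \<le> y"
proof
  show "a = inf a x + (a - inf a x)" by simp
  show "0 \<le> inf a x" "inf a x \<le> x" using assms by auto
  show "0 \<le> a - inf a x" by (simp only: diff_ge_0_iff_ge inf_le1)
  have "a - y \<le> inf a x" using assms by (simp only: le_inf_iff diff_le_eq) simp
  then show "a - inf a x \<le> y" by (simp only: diff_le_eq add.commute)
qed

text \<open>The part \<open>z\<close> of the excess of \<open>b\<close> over \<open>s'\<close> that
  lies below \<open>e\<close> can be added up forever without leaving \<open>b\<close>: if
  \<open>n z \<le> b\<close>, then \<open>n z\<close> is below the truncation
  \<open>inf b (n e)\<close>, hence below \<open>s'\<close>, and one more \<open>z\<close> still
  fits. So \<open>z = 0\<close> by the Archimedean property.\<close>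

lemma weak_order_unit_dominates:
  fixes b e s :: "'a::dedekind_complete_riesz_space"
  assumes e: "weak_order_unit e" and b: "0 \<le> b"
    and le: "\<And>n::nat. inf b (real n *\<^sub>R e) \<le> s"
  shows "b \<le> s"
proof -
  define s' where "s' = inf s b"
  have le': "inf b (real n *\<^sub>R e) \<le> s'" for n using le by (simp add: s'_def)
  have w: "0 \<le> b - s'" by (simp only: diff_ge_0_iff_ge s'_def inf_le2)
  have e0: "0 \<le> e" using e by (simp add: weak_order_unit_def)
  define z where "z = inf (b - s') e"
  have z0: "0 \<le> z" using w e0 by (simp add: z_def)
  have "real n *\<^sub>R z \<le> b" for n :: nat
  proof (induction n)
    case 0
    then show ?case using b by simp
  next
    case (Suc n)
    have "real n *\<^sub>R z \<le> real n *\<^sub>R e" by (intro scaleR_left_mono) (auto simp: z_def)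
    with Suc have "real n *\<^sub>R z \<le> s'" using le'[of n] by (meson le_inf_iff order_trans)
    then have "real n *\<^sub>R z + z \<le> s' + (b - s')" by (intro add_mono) (auto simp: z_def)
    then show ?case by (simp add: algebra_simps)
  qed
  then have "z \<le> 0" by (rule riesz_archimedean)
  then have "z = 0" using z0 by (rule antisym)
  then have "inf \<bar>b - s'\<bar> e = 0" using w by (simp add: z_def)
  then have "b - s' = 0" using e unfolding weak_order_unit_def by blast
  then have "b = s'" by simp
  also have "s' \<le> s" by (simp add: s'_def)
  finally show ?thesis .
qed

section \<open>Components of the unit\<close>

lemma band_proj_has_sup:
  fixes v w :: "'a::dedekind_complete_riesz_space"
  shows "has_sup (range (\<lambda>n::nat. inf w (real n *\<^sub>R v))) (band_proj v w)"
  unfolding band_proj_def by (rule has_sup_Sup) (auto simp: bdd_above_def intro: exI[of _ w])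

lemma band_proj_le:
  fixes v w :: "'a::dedekind_complete_riesz_space"
  shows "band_proj v w \<le> w"
  by (rule has_sup_least[OF band_proj_has_sup]) auto

lemma inf_le_band_proj:
  fixes v w :: "'a::dedekind_complete_riesz_space"
  shows "inf w (real n *\<^sub>R v) \<le> band_proj v w"
  by (rule has_sup_upper[OF band_proj_has_sup]) auto

lemma band_proj_nonneg:
  fixes v w :: "'a::dedekind_complete_riesz_space"
  assumes "0 \<le> w"
  shows "0 \<le> band_proj v w"
  using inf_le_band_proj[of w 0 v] assms by (simp add: inf_absorb2[OF assms])

lemma band_proj_mono:
  fixes v w :: "'a::dedekind_complete_riesz_space"
  assumes "v \<le> v'"
  shows "band_proj v w \<le> band_proj v' w"
proof (rule has_sup_least[OF band_proj_has_sup])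
  fix a assume "a \<in> range (\<lambda>n::nat. inf w (real n *\<^sub>R v))"
  then obtain n :: nat where "a = inf w (real n *\<^sub>R v)" by auto
  also have "\<dots> \<le> inf w (real n *\<^sub>R v')" using assms by (intro inf_mono scaleR_left_mono) auto
  also have "\<dots> \<le> band_proj v' w" by (rule inf_le_band_proj)
  finally show "a \<le> band_proj v' w" .
qed

lemma band_proj_inf_eq_0:
  fixes v w :: "'a::dedekind_complete_riesz_space"
  assumes "inf v x = 0" "0 \<le> v" "0 \<le> x" "0 \<le> w"
  shows "inf (band_proj v w) x = 0"
proof (rule has_sup_inf_eq_0[OF band_proj_has_sup])
  fix a assume "a \<in> range (\<lambda>n::nat. inf w (real n *\<^sub>R v))"
  then obtain n :: nat where a: "a = inf w (real n *\<^sub>R v)" by auto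
  have xv: "inf x v = 0" using assms(1) by (simp add: inf_commute)
  have "inf x (real n *\<^sub>R v) = 0" by (rule inf_scaleR_nat_eq_0[OF assms(3,2) xv])
  then have "inf (real n *\<^sub>R v) x = 0" by (simp add: inf_commute)
  then show "inf a x = 0"
    unfolding a
    by (rule inf_eq_0_mono) (use assms(2-4) scaleR_nonneg_nonneg[of "real n" v] in simp_all)
qed

text \<open>Adding the infimum in question to an approximant \<open>inf e (n v)\<close> stays below
  the next approximant, so the supremum \<open>band_proj v e\<close> absorbs it.\<close>

lemma diff_band_proj_disjoint:
  fixes v e :: "'a::dedekind_complete_riesz_space"
  assumes "0 \<le> v" "0 \<le> e"
  shows "inf v (e - band_proj v e) = 0"
proof -
  let ?z = "band_proj v e" and ?w = "inf v (e - band_proj v e)"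
  have w0: "0 \<le> ?w" using assms band_proj_le[of v e] by simp
  have "?z \<le> ?z - ?w"
  proof (rule has_sup_least[OF band_proj_has_sup])
    fix a assume "a \<in> range (\<lambda>n::nat. inf e (real n *\<^sub>R v))"
    then obtain n :: nat where a: "a = inf e (real n *\<^sub>R v)" by auto
    have "a \<le> ?z" using inf_le_band_proj a by simp
    then have "a + ?w \<le> ?z + (e - ?z)" by (rule add_mono[OF _ inf_le2])
    moreover have "a + ?w \<le> real n *\<^sub>R v + v" unfolding a by (rule add_mono[OF inf_le2 inf_le1])
    ultimately have "a + ?w \<le> inf e (real n *\<^sub>R v + v)" by simp
    then have "a + ?w \<le> inf e (real (Suc n) *\<^sub>R v)" by (simp add: scaleR_left_distrib add.commute)
    also have "\<dots> \<le> ?z" by (rule inf_le_band_proj)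
    finally show "a \<le> ?z - ?w" by (simp only: le_diff_eq)
  qed
  then have "?w \<le> 0" by (simp only: le_diff_eq add_le_same_cancel1)
  with w0 show ?thesis by (intro antisym)
qed

lemma band_proj_component:
  fixes v e :: "'a::dedekind_complete_riesz_space"
  assumes "0 \<le> v" "0 \<le> e"
  shows "inf (band_proj v e) (e - band_proj v e) = 0"
proof (rule band_proj_inf_eq_0[OF diff_band_proj_disjoint[OF assms] assms(1) _ assms(2)])
  show "0 \<le> e - band_proj v e" using band_proj_le[of v e] by (simp only: diff_ge_0_iff_ge)
qed

text \<open>Exhausting the unit by components reduces boundedness to boundedness on each of the disjoint
  pieces \<open>c (Suc m) - c m\<close>; lateral completeness glues the bounds.\<close>

lemma bdd_above_by_exhaustion:
  fixes B :: "'u::dedekind_complete_riesz_space set" and c :: "nat \<Rightarrow> 'u"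
  assumes lc: "laterally_complete TYPE('u)" and e: "weak_order_unit e"
    and c0: "\<And>m. 0 \<le> c m" and mono: "mono c" and comp: "\<And>m. inf (c m) (e - c m) = 0"
    and sup: "has_sup (range c) e"
    and B: "\<And>b. b \<in> B \<Longrightarrow> 0 \<le> b"
    and bd: "\<And>m b. b \<in> B \<Longrightarrow> \<exists>r. 0 \<le> r \<and> b \<le> u m + r \<and> inf r (c m) = 0"
    and u0: "\<And>m. 0 \<le> u m"
  shows "bdd_above B"
proof -
  define d where "d m = (case m of 0 \<Rightarrow> c 0 | Suc k \<Rightarrow> c (Suc k) - c k)" for m
  have ce: "c m \<le> e" for m using has_sup_upper[OF sup] by auto
  have e0: "0 \<le> e" using c0 ce by (blast intro: order_trans)
  have d0: "0 \<le> d m" for m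
    using c0[of 0] monoD[OF mono, of "m - 1" m] by (cases m) (simp_all add: d_def)
  have dc: "d m \<le> c m" for m
    using c0[of "m - 1"] by (cases m) (simp_all add: d_def)
  have de: "d m \<le> e - c k" if "k < m" for k m
  proof -
    obtain i where i: "m = Suc i" using \<open>k < m\<close> by (cases m) auto
    then have "c k \<le> c i" using that by (intro monoD[OF mono]) auto
    then show ?thesis using ce[of "Suc i"] by (simp add: d_def i diff_mono)
  qed
  have disj': "inf (d k) (d m) = 0" if "k < m" for k m
    using inf_eq_0_mono[OF comp[of k] d0 dc d0 de[OF that]] .
  then have disj: "inf (d k) (d m) = 0" if "k \<noteq> m" for k m
    using that by (metis inf_commute linorder_neqE_nat)
  have csum: "c M = (\<Sum>m\<le>M. d m)" for M
    by (induction M) (auto simp: d_def)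
  \<comment> \<open>The bound \<open>u m\<close> is valid only on \<open>c m\<close>, so just its
    part in the band of \<open>d m\<close> is kept; these parts are pairwise disjoint, as lateral
    completeness demands.\<close>
  define v where "v m = band_proj (d m) (u m)" for m
  have v0: "0 \<le> v m" for m unfolding v_def by (rule band_proj_nonneg[OF u0])
  have vd: "inf (v k) (v m) = 0" if "k \<noteq> m" for k m
  proof -
    have "inf (v k) (d m) = 0" unfolding v_def
      by (rule band_proj_inf_eq_0[OF disj[OF that] d0 d0 u0])
    then have "inf (v m) (v k) = 0" unfolding v_def[of m]
      by (intro band_proj_inf_eq_0) (auto simp: inf_commute d0 v0 u0)
    then show ?thesis by (simp add: inf_commute)
  qed
  have "range v \<noteq> {} \<and> (\<forall>a\<in>range v. 0 \<le> a) \<and> (\<forall>a\<in>range v. \<forall>b\<in>range v. a \<noteq> b \<longrightarrow> inf a b = 0)"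
  proof (intro conjI ballI impI)
    fix a b assume "a \<in> range v" "b \<in> range v" and ab: "a \<noteq> b"
    then obtain k m where km: "a = v k" "b = v m" by blast
    then show "inf a b = 0" using ab vd[of k m] by (cases "k = m") simp_all
  qed (use v0 in auto)
  from lc[unfolded laterally_complete_def, THEN spec, THEN mp, OF this]
  obtain s where s: "\<And>m. v m \<le> s" by auto
  have s0: "0 \<le> s" using v0[of 0] s[of 0] by (rule order_trans)
  \<comment> \<open>Disjoint sums are suprema, so they stay below \<open>s\<close>; disjointness
    from the later \<open>v k\<close> carries the induction.\<close>
  have vsum: "(\<Sum>m<M. v m) \<le> s \<and> (\<forall>k\<ge>M. inf (\<Sum>m<M. v m) (v k) = 0)" for M
  proof (induction M)
    case 0
    then show ?case using s0 v0 by (simp add: inf_absorb1)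
  next
    case (Suc M)
    have sM: "0 \<le> (\<Sum>m<M. v m)" by (intro sum_nonneg v0)
    have "(\<Sum>m<Suc M. v m) = sup (\<Sum>m<M. v m) (v M)"
      using Suc add_eq_sup_of_disjoint by auto
    moreover have "inf (\<Sum>m<Suc M. v m) (v k) = 0" if "Suc M \<le> k" for k
    proof (rule antisym)
      have "inf (\<Sum>m<Suc M. v m) (v k) \<le> inf (\<Sum>m<M. v m) (v k) + inf (v M) (v k)"
        using sM v0 by (auto intro: inf_add_le)
      also have "\<dots> = 0" using Suc that vd by auto
      finally show "inf (\<Sum>m<Suc M. v m) (v k) \<le> 0" .
      show "0 \<le> inf (\<Sum>m<Suc M. v m) (v k)" using v0 sM by auto
    qed
    ultimately show ?case using Suc s by auto
  qed
  have "b \<le> s" if b: "b \<in> B" for b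
  proof (rule weak_order_unit_dominates[OF e B[OF b]])
    \<comment> \<open>In the band of \<open>d m\<close> the remainder \<open>r\<close> vanishes,
      being disjoint from \<open>c m\<close>.\<close>
    have piece: "inf (real n *\<^sub>R d m) b \<le> v m" for n m
    proof -
      obtain r where r: "0 \<le> r" "b \<le> u m + r" "inf r (c m) = 0" using bd[OF b] by blast
      have rd: "inf r (d m) = 0" using inf_eq_0_mono[OF r(3) r(1) order_refl d0 dc] .
      have nd: "0 \<le> real n *\<^sub>R d m" using d0 by (simp add: scaleR_nonneg_nonneg)
      have "inf (real n *\<^sub>R d m) b \<le> inf (u m + r) (real n *\<^sub>R d m)"
        using r(2) by (simp add: le_infI2)
      also have "\<dots> \<le> inf (u m) (real n *\<^sub>R d m) + inf r (real n *\<^sub>R d m)"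
        by (rule inf_add_le[OF u0 r(1) nd])
      also have "inf r (real n *\<^sub>R d m) = 0" by (rule inf_scaleR_nat_eq_0[OF r(1) d0 rd])
      also have "inf (u m) (real n *\<^sub>R d m) + 0 \<le> v m" by (simp add: v_def inf_le_band_proj)
      finally show ?thesis .
    qed
    have fin: "inf (real n *\<^sub>R c M) b \<le> s" for n M
    proof -
      have "inf (\<Sum>m<K. real n *\<^sub>R d m) b \<le> (\<Sum>m<K. v m)" for K
      proof (induction K)
        case 0
        then show ?case using B[OF b] by (simp add: inf_absorb1)
      next
        case (Suc K)
        have "inf ((\<Sum>m<K. real n *\<^sub>R d m) + real n *\<^sub>R d K) b
            \<le> inf (\<Sum>m<K. real n *\<^sub>R d m) b + inf (real n *\<^sub>R d K) b"
          using d0 B[OF b] by (intro inf_add_le sum_nonneg) (auto simp: scaleR_nonneg_nonneg)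
        also have "\<dots> \<le> (\<Sum>m<K. v m) + v K" by (intro add_mono Suc piece)
        finally show ?case by simp
      qed
      from this[of "Suc M"] vsum[of "Suc M", THEN conjunct1]
      have "inf (\<Sum>m<Suc M. real n *\<^sub>R d m) b \<le> s" by (rule order_trans)
      then show ?thesis
        by (simp add: csum scaleR_sum_right lessThan_Suc_atMost del: sum.atMost_Suc sum.lessThan_Suc)
    qed
    fix n :: nat
    show "inf b (real n *\<^sub>R e) \<le> s"
    proof (cases "n = 0")
      case True
      then show ?thesis using B[OF b] s0 by (simp add: inf_absorb2)
    next
      case False
      \<comment> \<open>Now \<open>M\<close> grows: the elements \<open>n c M\<close> have supremum
        \<open>n e\<close>.\<close>
      then have "has_sup ((\<lambda>x. inf x b) ` (\<lambda>x. real n *\<^sub>R x) ` range c) (inf (real n *\<^sub>R e) b)"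
        by (intro has_sup_inf has_sup_scaleR sup) auto
      then have "inf (real n *\<^sub>R e) b \<le> s" by (rule has_sup_least) (auto simp: fin)
      then show ?thesis by (simp add: inf_commute)
    qed
  qed
  then show ?thesis by (auto simp: bdd_above_def)
qed

section \<open>Order continuous operators\<close>

lemma riesz_hom_linear: "riesz_hom F \<Longrightarrow> linear F"
  by (simp add: riesz_hom_def)

lemma riesz_hom_sup: "riesz_hom F \<Longrightarrow> F (sup x y) = sup (F x) (F y)"
  by (simp add: riesz_hom_def)

lemma riesz_hom_inf:
  assumes "riesz_hom F"
  shows "F (inf x y) = inf (F x) (F y)"
proof -
  have eq: "inf x y = x + y - sup x y" for x y :: "'z::riesz_space"
    using add_eq_inf_sup[of x y] by simp
  show ?thesis
    unfolding eq linear_diff[OF riesz_hom_linear[OF assms]] linear_add[OF riesz_hom_linear[OF assms]]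
      riesz_hom_sup[OF assms] ..
qed

lemma riesz_hom_mono:
  assumes "riesz_hom F" "x \<le> y"
  shows "F x \<le> F y"
proof -
  have "sup (F x) (F y) = F y"
    using assms(2) by (simp add: riesz_hom_sup[OF assms(1), symmetric] sup_absorb2)
  then show ?thesis by (metis sup_ge1)
qed

lemma riesz_hom_nonneg: "riesz_hom F \<Longrightarrow> 0 \<le> x \<Longrightarrow> 0 \<le> F x"
  using riesz_hom_mono[of F 0 x] linear_0[OF riesz_hom_linear] by metis

text \<open>The common interface of \<open>T\<close> and \<open>S\<close>, so that the extension to
  the universal completion is built once.\<close>

definition normal_operator ::
  "('a::dedekind_complete_riesz_space \<Rightarrow> 'b::dedekind_complete_riesz_space) \<Rightarrow> bool" where
  "normal_operator F \<longleftrightarrow> linear F \<and> (\<forall>x\<ge>0. 0 \<le> F x) \<and> order_continuous F"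

lemma normal_operator_linear: "normal_operator F \<Longrightarrow> linear F"
  by (simp add: normal_operator_def)

lemma normal_operator_nonneg: "normal_operator F \<Longrightarrow> 0 \<le> x \<Longrightarrow> 0 \<le> F x"
  by (simp add: normal_operator_def)

lemma normal_operator_mono:
  assumes "normal_operator F" "x \<le> y"
  shows "F x \<le> F y"
  using normal_operator_nonneg[OF assms(1), of "y - x"] assms(2)
  by (simp add: linear_diff[OF normal_operator_linear[OF assms(1)]])

text \<open>The differences \<open>s - a\<close> decrease to 0, the only situation of which
  \<open>order_continuous\<close> speaks.\<close>

lemma normal_operator_has_sup:
  assumes F: "normal_operator F" and A: "up_directed A" and s: "has_sup A s"
  shows "has_sup (F ` A) (F s)"
proof (rule has_supI)
  show "F ` A \<noteq> {}" using has_sup_nonempty[OF s] by simp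
  show "b \<le> F s" if "b \<in> F ` A" for b
    using that normal_operator_mono[OF F has_sup_upper[OF s]] by blast
  fix u assume u: "\<And>b. b \<in> F ` A \<Longrightarrow> b \<le> u"
  let ?D = "(\<lambda>a. s - a) ` A"
  have "down_directed ?D"
    unfolding down_directed_def
  proof (intro conjI ballI)
    show "?D \<noteq> {}" using has_sup_nonempty[OF s] by simp
    fix p r assume "p \<in> ?D" "r \<in> ?D"
    then obtain a b where ab: "a \<in> A" "b \<in> A" "p = s - a" "r = s - b" by blast
    with A obtain c where "c \<in> A" "a \<le> c" "b \<le> c" unfolding up_directed_def by blast
    then show "\<exists>c\<in>?D. c \<le> p \<and> c \<le> r" using ab by (intro bexI[of _ "s - c"]) (auto intro: diff_left_mono)
  qed
  moreover have lb: "0 \<le> d" if "d \<in> ?D" for d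
    using that has_sup_upper[OF s] by auto
  moreover from lb have "bdd_below ?D" by (rule bdd_belowI)
  moreover have "Inf ?D = 0"
  proof (rule cInf_eq_non_empty)
    show "?D \<noteq> {}" using has_sup_nonempty[OF s] by simp
    fix y assume y: "\<And>x. x \<in> ?D \<Longrightarrow> y \<le> x"
    have "s \<le> s - y"
    proof (rule has_sup_least[OF s])
      fix a assume "a \<in> A"
      then have "y \<le> s - a" by (intro y) blast
      then show "a \<le> s - y" by (simp add: le_diff_eq add.commute)
    qed
    then show "y \<le> 0" by simp
  qed (rule lb)
  ultimately have Inf0: "Inf ((\<lambda>x. \<bar>F x\<bar>) ` ?D) = 0"
    using F unfolding normal_operator_def order_continuous_def by blast
  have "F s - u \<le> Inf ((\<lambda>x. \<bar>F x\<bar>) ` ?D)"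
  proof (rule cInf_greatest)
    show "(\<lambda>x. \<bar>F x\<bar>) ` ?D \<noteq> {}" using has_sup_nonempty[OF s] by simp
    fix y assume "y \<in> (\<lambda>x. \<bar>F x\<bar>) ` ?D"
    then obtain a where a: "a \<in> A" "y = \<bar>F (s - a)\<bar>" by blast
    have "F s - u \<le> F s - F a" using u a(1) by (intro diff_left_mono) blast
    also have "\<dots> = F (s - a)" by (rule linear_diff[OF normal_operator_linear[OF F], symmetric])
    also have "\<dots> \<le> y" unfolding a(2) by (rule abs_ge_self)
    finally show "F s - u \<le> y" .
  qed
  then show "F s \<le> u" unfolding Inf0 by simp
qed

text \<open>Finite suprema are preserved by a lattice homomorphism, so \<open>A\<close> may be
  replaced by the directed set of its finite suprema. This covers truncated lower sums without
  constructing common refinements of partitions.\<close>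

lemma normal_riesz_hom_has_sup:
  assumes h: "riesz_hom F" and F: "normal_operator F" and s: "has_sup A s"
  shows "has_sup (F ` A) (F s)"
proof (rule has_supI)
  show "F ` A \<noteq> {}" using has_sup_nonempty[OF s] by simp
  show "b \<le> F s" if "b \<in> F ` A" for b
    using that normal_operator_mono[OF F has_sup_upper[OF s]] by blast
  fix u assume u: "\<And>b. b \<in> F ` A \<Longrightarrow> b \<le> u"
  define G where "G = {Sup_fin X | X. X \<subseteq> A \<and> finite X \<and> X \<noteq> {}}"
  have AG: "A \<subseteq> G"
  proof
    fix a assume "a \<in> A"
    then show "a \<in> G" unfolding G_def by (intro CollectI exI[of _ "{a}"]) simp
  qed
  have "up_directed G"
    unfolding up_directed_def
  proof (intro conjI ballI)
    show "G \<noteq> {}" using AG has_sup_nonempty[OF s] by blast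
    fix p r assume "p \<in> G" "r \<in> G"
    then obtain X Y where X: "X \<subseteq> A" "finite X" "X \<noteq> {}" "p = Sup_fin X"
      and Y: "Y \<subseteq> A" "finite Y" "Y \<noteq> {}" "r = Sup_fin Y" unfolding G_def by blast
    then have "Sup_fin (X \<union> Y) \<in> G" unfolding G_def by blast
    moreover have "Sup_fin (X \<union> Y) = sup p r" using X Y by (simp add: Sup_fin.union)
    ultimately show "\<exists>c\<in>G. p \<le> c \<and> r \<le> c" by (intro bexI[of _ "sup p r"]) simp_all
  qed
  moreover have "has_sup G s"
  proof (rule has_supI)
    show "G \<noteq> {}" using AG has_sup_nonempty[OF s] by blast
    show "g \<le> s" if "g \<in> G" for g
    proof -
      obtain X where X: "X \<subseteq> A" "finite X" "X \<noteq> {}" "g = Sup_fin X"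
        using \<open>g \<in> G\<close> unfolding G_def by blast
      show ?thesis unfolding X(4)
        using X(1) has_sup_upper[OF s] by (intro Sup_fin.boundedI X(2,3)) blast
    qed
    fix w assume "\<And>g. g \<in> G \<Longrightarrow> g \<le> w"
    then show "s \<le> w" using AG by (intro has_sup_least[OF s]) blast
  qed
  ultimately have "has_sup (F ` G) (F s)" by (rule normal_operator_has_sup[OF F])
  moreover have "F (Sup_fin X) \<le> u" if "finite X" "X \<noteq> {}" "X \<subseteq> A" for X
    using that
  proof (induction rule: finite_ne_induct)
    case (singleton x)
    then show ?case using u by simp
  next
    case (insert x X)
    then have "F x \<le> u" "F (Sup_fin X) \<le> u" using u by simp_all
    then show ?case using insert by (simp add: riesz_hom_sup[OF h])
  qed
  ultimately show "F s \<le> u" by (elim has_sup_least) (auto simp: G_def)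
qed

text \<open>Two representations \<open>x - y = x' - y'\<close> are compared through
  \<open>x + y' = x' + y\<close>, an identity inside the cone where \<open>G\<close> is
  additive.\<close>

lemma linear_extension_eq:
  assumes add: "\<And>x y. x \<in> C \<Longrightarrow> y \<in> C \<Longrightarrow> x + y \<in> C \<and> G (x + y) = G x + G y"
    and xy: "x \<in> C" "y \<in> C"
  shows "linear_extension C G (x - y) = G x - G y"
  unfolding linear_extension_def
proof (rule the_equality)
  show "\<exists>x'\<in>C. \<exists>y'\<in>C. x - y = x' - y' \<and> G x - G y = G x' - G y'" using xy by blast
  fix w assume "\<exists>x'\<in>C. \<exists>y'\<in>C. x - y = x' - y' \<and> w = G x' - G y'"
  then obtain x' y' where *: "x' \<in> C" "y' \<in> C" "x - y = x' - y'" "w = G x' - G y'" by blast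
  then have "x + y' = x' + y" by (simp add: algebra_simps)
  then have "G x + G y' = G x' + G y" using add[OF xy(1) *(2)] add[OF *(1) xy(2)] by simp
  then have "G x = G x' + G y - G y'" by (simp only: eq_diff_eq)
  then have "G x - G y = G x' - G y'" 
    by (simp only: diff_eq_eq) (simp add: algebra_simps)
  then show "w = G x - G y" using *(4) by simp
qed

section \<open>The universal completion\<close>

locale universal_completion_embedding =
  fixes j :: "'a::dedekind_complete_riesz_space \<Rightarrow> 'u::dedekind_complete_riesz_space"
  assumes uc: "universal_completion j"
begin

lemma j_hom: "riesz_hom j"
  and lateral: "laterally_complete TYPE('u)"
  and dense: "0 < u \<Longrightarrow> \<exists>x>0. j x \<le> u"
  and j_inj: "inj j"
  using uc by (simp_all add: universal_completion_def)

lemmas j_linear = riesz_hom_linear[OF j_hom]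
lemmas j_add = linear_add[OF j_linear]
lemmas j_diff = linear_diff[OF j_linear]
lemmas j_scaleR = linear_scale[OF j_linear]
lemmas j_0 = linear_0[OF j_linear]
lemmas j_sup = riesz_hom_sup[OF j_hom]
lemmas j_inf = riesz_hom_inf[OF j_hom]
lemmas j_mono = riesz_hom_mono[OF j_hom]
lemmas j_nonneg = riesz_hom_nonneg[OF j_hom]

lemma j_le_iff: "j x \<le> j y \<longleftrightarrow> x \<le> y"
proof
  assume "j x \<le> j y"
  then have "j (sup x y) = j y" by (simp add: j_sup sup_absorb2)
  then have "sup x y = y" using j_inj by (simp add: inj_eq)
  then show "x \<le> y" by (metis sup_ge1)
qed (rule j_mono)

lemma j_eq_iff: "j x = j y \<longleftrightarrow> x = y"
  using j_inj by (simp add: inj_eq)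

lemma j_nonneg_iff: "0 \<le> j x \<longleftrightarrow> 0 \<le> x"
  using j_le_iff[of 0 x] by (simp add: j_0)

text \<open>Suprema survive the embedding by order density: if an upper bound \<open>u\<close> were
  not above \<open>j s\<close>, some \<open>j y\<close> with \<open>y > 0\<close> would fit into the
  gap, and \<open>s - y\<close> would already bound \<open>A\<close>.\<close>

lemma has_sup_j_iff: "has_sup (j ` A) (j s) \<longleftrightarrow> has_sup A s"
proof
  assume s: "has_sup (j ` A) (j s)"
  show "has_sup A s"
  proof (rule has_supI)
    show "A \<noteq> {}" using has_sup_nonempty[OF s] by simp
    show "a \<le> s" if "a \<in> A" for a using has_sup_upper[OF s imageI[OF that]] by (simp only: j_le_iff)
    show "s \<le> u" if "\<And>a. a \<in> A \<Longrightarrow> a \<le> u" for u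
    proof -
      have "j s \<le> j u" by (rule has_sup_least[OF s]) (use that in \<open>auto simp: j_le_iff\<close>)
      then show ?thesis by (simp add: j_le_iff)
    qed
  qed
next
  assume s: "has_sup A s"
  show "has_sup (j ` A) (j s)"
  proof (rule has_supI)
    show "j ` A \<noteq> {}" using has_sup_nonempty[OF s] by simp
    show "b \<le> j s" if "b \<in> j ` A" for b using has_sup_upper[OF s] that by (auto simp: j_le_iff)
    fix u assume u: "\<And>b. b \<in> j ` A \<Longrightarrow> b \<le> u"
    show "j s \<le> u"
    proof (rule ccontr)
      assume "\<not> j s \<le> u"
      then have "inf (j s) u \<noteq> j s" by (metis inf_le2)
      then have "0 < j s - inf (j s) u" by (simp add: less_le)
      then obtain y where y: "0 < y" "j y \<le> j s - inf (j s) u" using dense by blast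
      have "s \<le> s - y"
      proof (rule has_sup_least[OF s])
        fix a assume "a \<in> A"
        then have "j a \<le> inf (j s) u" using u has_sup_upper[OF s] by (simp add: j_le_iff)
        then have "j a + j y \<le> inf (j s) u + (j s - inf (j s) u)" using y(2) by (rule add_mono)
        then have "j (a + y) \<le> j s" by (simp add: j_add)
        then show "a \<le> s - y" by (simp add: j_le_iff le_diff_eq)
      qed
      then show False using y(1) by simp
    qed
  qed
qed

definition lower_part :: "'u \<Rightarrow> 'a set" where
  "lower_part x = {a. 0 \<le> a \<and> j a \<le> x}"

lemma has_sup_lower_part:
  assumes "0 \<le> x"
  shows "has_sup (j ` lower_part x) x"
proof (rule has_supI)
  have zero: "0 \<in> lower_part x" using assms by (simp add: lower_part_def j_0)
  then show "j ` lower_part x \<noteq> {}" by blast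
  show "b \<le> x" if "b \<in> j ` lower_part x" for b using that by (auto simp: lower_part_def)
  fix u assume u: "\<And>b. b \<in> j ` lower_part x \<Longrightarrow> b \<le> u"
  show "x \<le> u"
  proof (rule ccontr)
    assume "\<not> x \<le> u"
    then have "inf x u \<noteq> x" by (metis inf_le2)
    then have "0 < x - inf x u" by (simp add: less_le)
    then obtain y where y: "0 < y" "j y \<le> x - inf x u" using dense by blast
    \<comment> \<open>Each multiple in the lower part is below \<open>u\<close>, so the gap leaves
      room for one more \<open>y\<close>; this contradicts the Archimedean property.\<close>
    have "real n *\<^sub>R y \<in> lower_part x" for n :: nat
    proof (induction n)
      case 0
      then show ?case using zero by simp
    next
      case (Suc n)
      then have "j (real n *\<^sub>R y) \<le> inf x u" using u by (simp add: lower_part_def)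
      then have "j (real n *\<^sub>R y) + j y \<le> inf x u + (x - inf x u)" using y(2) by (rule add_mono)
      then have "j (real n *\<^sub>R y + y) \<le> x" by (simp add: j_add)
      moreover have "0 \<le> real n *\<^sub>R y + y" using Suc y(1) by (simp add: lower_part_def)
      ultimately show ?case by (simp add: lower_part_def scaleR_left_distrib add.commute)
    qed
    then have "real n *\<^sub>R j y \<le> x" for n :: nat by (simp add: lower_part_def j_scaleR)
    then have "j y \<le> 0" by (rule riesz_archimedean)
    then have "y \<le> 0" using j_le_iff[of y 0] by (simp add: j_0)
    with y(1) show False by simp
  qed
qed

lemma up_directed_lower_part:
  assumes "0 \<le> x"
  shows "up_directed (lower_part x)"
  unfolding up_directed_def
proof (intro conjI ballI)
  show "lower_part x \<noteq> {}" using has_sup_nonempty[OF has_sup_lower_part[OF assms]] by simp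
  fix a b assume "a \<in> lower_part x" "b \<in> lower_part x"
  then have "sup a b \<in> lower_part x" by (simp add: lower_part_def j_sup le_supI1)
  then show "\<exists>c\<in>lower_part x. a \<le> c \<and> b \<le> c" by (intro bexI[of _ "sup a b"]) simp_all
qed

lemma increases_to_iff:
  "increases_to j A x \<longleftrightarrow> up_directed A \<and> (\<forall>a\<in>A. 0 \<le> a) \<and> has_sup (j ` A) x"
proof
  assume A: "increases_to j A x"
  then have "A \<noteq> {}" by (simp add: increases_to_def up_directed_def)
  then show "up_directed A \<and> (\<forall>a\<in>A. 0 \<le> a) \<and> has_sup (j ` A) x"
    using A has_sup_Sup[of "j ` A"] by (simp add: increases_to_def)
next
  assume "up_directed A \<and> (\<forall>a\<in>A. 0 \<le> a) \<and> has_sup (j ` A) x"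
  then show "increases_to j A x"
    using has_sup_bdd[of "j ` A" x] Sup_eq_has_sup[of "j ` A" x] by (simp add: increases_to_def)
qed

lemma increases_to_lower_part: "0 \<le> x \<Longrightarrow> increases_to j (lower_part x) x"
  unfolding increases_to_iff
  by (intro conjI has_sup_lower_part up_directed_lower_part) (simp_all add: lower_part_def)

text \<open>The lower part of \<open>u\<close> is bounded by \<open>a\<close>, so it has a supremum
  in the Dedekind complete original space, and \<open>j\<close> carries that supremum to
  \<open>u\<close>.\<close>

lemma range_j_ideal:
  assumes "0 \<le> u" "u \<le> j a"
  obtains b where "u = j b"
proof
  let ?L = "lower_part u"
  have "b \<le> a" if "b \<in> ?L" for b
  proof -
    have "j b \<le> u" using that by (simp add: lower_part_def)
    then have "j b \<le> j a" using assms(2) by (rule order_trans)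
    then show ?thesis by (simp add: j_le_iff)
  qed
  then have "has_sup ?L (Sup ?L)"
    using has_sup_nonempty[OF has_sup_lower_part[OF assms(1)]]
    by (intro has_sup_Sup bdd_aboveI[of _ a]) simp_all
  then have "has_sup (j ` ?L) (j (Sup ?L))" by (simp add: has_sup_j_iff)
  then show "u = j (Sup ?L)" by (rule has_sup_unique[OF has_sup_lower_part[OF assms(1)]])
qed

text \<open>The truncated net \<open>inf a b\<close> increases to \<open>b\<close> inside the
  original space, where order continuity of \<open>F\<close> applies. This is why the extension does
  not depend on the net.\<close>

lemma normal_operator_le:
  assumes F: "normal_operator F" and A: "increases_to j A x" and b: "0 \<le> b" "j b \<le> x"
    and u: "\<And>a. a \<in> A \<Longrightarrow> j (F a) \<le> u"
  shows "j (F b) \<le> u"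
proof -
  let ?B = "(\<lambda>a. inf a b) ` A"
  have A': "up_directed A" "has_sup (j ` A) x" using A by (simp_all add: increases_to_iff)
  have "has_sup ((\<lambda>v. inf v (j b)) ` j ` A) (inf x (j b))" by (rule has_sup_inf[OF A'(2)])
  then have "has_sup (j ` ?B) (j b)" using b(2) by (simp add: image_image j_inf inf_absorb2)
  then have "has_sup ?B b" by (simp only: has_sup_j_iff)
  moreover have "up_directed ?B"
    unfolding up_directed_def
  proof (intro conjI ballI)
    show "?B \<noteq> {}" using A'(1) by (simp add: up_directed_def)
    fix p r assume "p \<in> ?B" "r \<in> ?B"
    then obtain a a' where a: "a \<in> A" "a' \<in> A" "p = inf a b" "r = inf a' b" by blast
    with A'(1) obtain c where "c \<in> A" "a \<le> c" "a' \<le> c" unfolding up_directed_def by blast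
    then show "\<exists>c\<in>?B. p \<le> c \<and> r \<le> c"
      unfolding a by (intro bexI[of _ "inf c b"] conjI inf_mono) auto
  qed
  ultimately have "has_sup (F ` ?B) (F b)" by (intro normal_operator_has_sup[OF F])
  then have "has_sup (j ` F ` ?B) (j (F b))" by (simp only: has_sup_j_iff)
  then show ?thesis
  proof (rule has_sup_least)
    fix y assume "y \<in> j ` F ` ?B"
    then obtain a where a: "a \<in> A" "y = j (F (inf a b))" by blast
    have "y \<le> j (F a)" unfolding a(2) by (intro j_mono normal_operator_mono[OF F]) simp
    then show "y \<le> u" using u[OF a(1)] by (rule order_trans)
  qed
qed

section \<open>Extension of a normal operator along the canonical net\<close>

definition ext_dom :: "('a \<Rightarrow> 'a) \<Rightarrow> 'u set" where
  "ext_dom F = {x. 0 \<le> x \<and> bdd_above (j ` F ` lower_part x)}"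

definition ext :: "('a \<Rightarrow> 'a) \<Rightarrow> 'u \<Rightarrow> 'u" where
  "ext F x = Sup (j ` F ` lower_part x)"

lemma ext_dom_nonneg: "x \<in> ext_dom F \<Longrightarrow> 0 \<le> x"
  by (simp add: ext_dom_def)

lemma has_sup_ext: "x \<in> ext_dom F \<Longrightarrow> has_sup (j ` F ` lower_part x) (ext F x)"
  using has_sup_nonempty[OF has_sup_lower_part, of x] has_sup_Sup[of "j ` F ` lower_part x"]
  by (simp add: ext_dom_def ext_def)

lemma le_ext: "x \<in> ext_dom F \<Longrightarrow> 0 \<le> a \<Longrightarrow> j a \<le> x \<Longrightarrow> j (F a) \<le> ext F x"
  by (rule has_sup_upper[OF has_sup_ext]) (auto simp: lower_part_def)

text \<open>\<open>A\<close> is part of the canonical net, and by \<open>normal_operator_le\<close>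
  any bound over \<open>A\<close> is a bound over all of it.\<close>

lemma ext_of_increases:
  assumes F: "normal_operator F" and A: "increases_to j A x" and bdd: "bdd_above (j ` F ` A)"
  shows "x \<in> ext_dom F \<and> has_sup (j ` F ` A) (ext F x)"
proof -
  have ne: "A \<noteq> {}" using A by (simp add: increases_to_def up_directed_def)
  have le: "j a \<le> x" and a0: "0 \<le> a" if "a \<in> A" for a
    using A has_sup_upper[of "j ` A" x] that by (simp_all add: increases_to_iff)
  obtain a where a: "a \<in> A" using ne by blast
  have "0 \<le> x" using j_nonneg[OF a0[OF a]] le[OF a] by (rule order_trans)
  have s: "has_sup (j ` F ` A) (Sup (j ` F ` A))" using ne bdd by (intro has_sup_Sup) simp_all
  have "j (F b) \<le> Sup (j ` F ` A)" if "b \<in> lower_part x" for b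
    by (rule normal_operator_le[OF F A])
      (use that has_sup_upper[OF s] in \<open>auto simp: lower_part_def\<close>)
  then have "bdd_above (j ` F ` lower_part x)" by (intro bdd_aboveI[of _ "Sup (j ` F ` A)"]) blast
  then have x: "x \<in> ext_dom F" using \<open>0 \<le> x\<close> by (simp add: ext_dom_def)
  have "Sup (j ` F ` A) = ext F x"
  proof (rule antisym)
    show "Sup (j ` F ` A) \<le> ext F x"
      by (rule has_sup_least[OF s]) (use le_ext[OF x a0 le] in blast)
    show "ext F x \<le> Sup (j ` F ` A)"
      by (rule has_sup_least[OF has_sup_ext[OF x]])
        (use \<open>\<And>b. b \<in> lower_part x \<Longrightarrow> j (F b) \<le> Sup (j ` F ` A)\<close> in blast)
  qed
  with s x show ?thesis by simp
qed

lemma natural_cone_eq: "normal_operator F \<Longrightarrow> natural_cone j F = ext_dom F"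
proof (intro subset_antisym subsetI)
  fix x assume "normal_operator F" "x \<in> natural_cone j F"
  then show "x \<in> ext_dom F" using ext_of_increases unfolding natural_cone_def by blast
next
  fix x assume "x \<in> ext_dom F"
  then show "x \<in> natural_cone j F"
    using increases_to_lower_part[of x] unfolding natural_cone_def ext_dom_def by blast
qed

lemma cone_extension_eq:
  assumes F: "normal_operator F" and x: "x \<in> ext_dom F"
  shows "cone_extension j F x = ext F x"
  unfolding cone_extension_def
proof (rule the_equality)
  show "\<exists>A. increases_to j A x \<and> bdd_above (j ` F ` A) \<and> ext F x = Sup (j ` F ` A)"
    using increases_to_lower_part[of x] x unfolding ext_dom_def ext_def by blast
  fix y assume "\<exists>A. increases_to j A x \<and> bdd_above (j ` F ` A) \<and> y = Sup (j ` F ` A)"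
  then obtain A where A: "increases_to j A x" "bdd_above (j ` F ` A)" "y = Sup (j ` F ` A)" by blast
  show "y = ext F x" unfolding A(3)
    using ext_of_increases[OF F A(1,2)] by (intro Sup_eq_has_sup) simp
qed

lemma ext_dom_solid:
  assumes "x \<in> ext_dom F" "0 \<le> y" "y \<le> x"
  shows "y \<in> ext_dom F"
proof -
  have "lower_part y \<subseteq> lower_part x" using assms(3) by (auto simp: lower_part_def)
  then have "j ` F ` lower_part y \<subseteq> j ` F ` lower_part x" by (intro image_mono)
  with assms show ?thesis by (auto simp: ext_dom_def elim: bdd_above_mono)
qed

text \<open>Riesz decomposition splits the canonical net of \<open>x + y\<close> into the sum of the
  two nets; the ideal property puts the summands back into the original space.\<close>

lemma ext_add:
  assumes F: "linear F" and x: "x \<in> ext_dom F" and y: "y \<in> ext_dom F"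
  shows "x + y \<in> ext_dom F \<and> ext F (x + y) = ext F x + ext F y"
proof -
  have x0: "0 \<le> x" and y0: "0 \<le> y" using x y by (simp_all add: ext_dom_def)
  have split: "lower_part (x + y) = {a + b | a b. a \<in> lower_part x \<and> b \<in> lower_part y}"
  proof (intro subset_antisym subsetI)
    fix c assume "c \<in> lower_part (x + y)"
    then have c: "0 \<le> j c" "j c \<le> x + y" by (simp_all add: lower_part_def j_nonneg)
    obtain v w where vw: "j c = v + w" "0 \<le> v" "v \<le> x" "0 \<le> w" "w \<le> y"
      using riesz_decomposition[OF c x0 y0] by blast
    have "v \<le> j c" "w \<le> j c" using vw by simp_all
    then obtain a b where ab: "v = j a" "w = j b" using vw(2,4) range_j_ideal by metis
    have "c = a + b" using vw(1) by (simp add: ab j_add[symmetric] j_eq_iff)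
    moreover have "a \<in> lower_part x" "b \<in> lower_part y"
      using vw by (simp_all add: ab lower_part_def j_nonneg_iff)
    ultimately show "c \<in> {a + b | a b. a \<in> lower_part x \<and> b \<in> lower_part y}" by blast
  next
    fix c assume "c \<in> {a + b | a b. a \<in> lower_part x \<and> b \<in> lower_part y}"
    then show "c \<in> lower_part (x + y)" by (auto simp: lower_part_def j_add intro: add_mono)
  qed
  have "j ` F ` lower_part (x + y)
      = {a + b | a b. a \<in> j ` F ` lower_part x \<and> b \<in> j ` F ` lower_part y}"
  proof (intro subset_antisym subsetI)
    fix c assume "c \<in> j ` F ` lower_part (x + y)"
    then obtain a b where ab: "a \<in> lower_part x" "b \<in> lower_part y" "c = j (F (a + b))"
      unfolding split by blast
    have "c = j (F a) + j (F b)" by (simp add: ab(3) linear_add[OF F] j_add)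
    then show "c \<in> {a + b | a b. a \<in> j ` F ` lower_part x \<and> b \<in> j ` F ` lower_part y}"
      using ab(1,2) by blast
  next
    fix c assume "c \<in> {a + b | a b. a \<in> j ` F ` lower_part x \<and> b \<in> j ` F ` lower_part y}"
    then obtain a b where ab: "a \<in> lower_part x" "b \<in> lower_part y" "c = j (F a) + j (F b)"
      by blast
    have "c = j (F (a + b))" by (simp add: ab(3) linear_add[OF F] j_add)
    then show "c \<in> j ` F ` lower_part (x + y)" unfolding split using ab(1,2) by blast
  qed
  then have s: "has_sup (j ` F ` lower_part (x + y)) (ext F x + ext F y)"
    using has_sup_plus[OF has_sup_ext[OF x] has_sup_ext[OF y]] by simp
  show ?thesis
    using has_sup_bdd[OF s] Sup_eq_has_sup[OF s] x0 y0 by (simp add: ext_dom_def ext_def)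
qed

end

section \<open>Spectral systems and lower sums\<close>

lemma pprt_diff:
  fixes a b :: "'a::riesz_space"
  shows "pprt (a - b) = a - inf b a"
proof -
  have "a - inf b a = a + sup (- b) (- a)" by (rule diff_inf_eq_sup)
  also have "\<dots> = pprt (a - b)" by (simp add: add_sup_distrib_left pprt_def)
  finally show ?thesis ..
qed

lemma inf_pprt_neg:
  fixes x :: "'a::riesz_space"
  shows "inf (pprt x) (pprt (- x)) = 0"
proof -
  have pp: "pprt x = x - nprt x" by (rule eq_diff_eq[THEN iffD2, OF prts[symmetric]])
  have "inf (pprt x) (pprt (- x)) = inf (x - nprt x) (0 - nprt x)"
    by (simp add: pp pprt_neg)
  also have "\<dots> = inf x 0 - nprt x"
    using add_inf_distrib_right[of x 0 "- nprt x"] by simp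
  finally show ?thesis by (simp add: nprt_def)
qed

lemma le_add_pprt_diff:
  fixes a b :: "'a::riesz_space"
  shows "a \<le> b + pprt (a - b)"
proof -
  have "a - b \<le> pprt (a - b)" by (simp add: pprt_def)
  then show ?thesis by (simp only: diff_le_eq add.commute)
qed

text \<open>The pointwise Markov inequality \<open>r 1_{a > r} \<le> a\<close>. The part of
  \<open>r ?z\<close> above \<open>a\<close> lies below both \<open>r ?z\<close> and
  \<open>pprt (r e - a)\<close>, which are disjoint.\<close>

lemma scaleR_band_proj_le:
  fixes a e :: "'a::dedekind_complete_riesz_space"
  assumes a: "0 \<le> a" and e: "0 \<le> e" and r: "0 \<le> r"
  shows "r *\<^sub>R band_proj (pprt (a - r *\<^sub>R e)) e \<le> a"
proof -
  let ?z = "band_proj (pprt (a - r *\<^sub>R e)) e" and ?y = "pprt (r *\<^sub>R e - a)"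
  have z0: "0 \<le> ?z" by (rule band_proj_nonneg[OF e])
  have rz0: "0 \<le> r *\<^sub>R ?z" using r z0 by (rule scaleR_nonneg_nonneg)
  have "inf (pprt (a - r *\<^sub>R e)) ?y = 0" using inf_pprt_neg[of "a - r *\<^sub>R e"] by simp
  then have "inf ?z ?y = 0" by (rule band_proj_inf_eq_0) (simp_all add: e)
  then have "inf ?y ?z = 0" by (simp only: inf_commute)
  then have 0: "inf ?y (r *\<^sub>R ?z) = 0" by (intro inf_scaleR_eq_0 z0 r) simp_all
  have "r *\<^sub>R ?z \<le> r *\<^sub>R e" using band_proj_le r by (rule scaleR_left_mono)
  then have "pprt (r *\<^sub>R ?z - a) \<le> ?y" by (intro pprt_mono diff_right_mono)
  moreover have "pprt (r *\<^sub>R ?z - a) \<le> r *\<^sub>R ?z"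
    unfolding pprt_def[of "r *\<^sub>R ?z - a"] using a rz0 by (intro le_supI) simp_all
  ultimately have "pprt (r *\<^sub>R ?z - a) \<le> 0" using 0 by (metis le_inf_iff)
  then have "r *\<^sub>R ?z - a \<le> 0" by (simp add: pprt_def)
  then show ?thesis by simp
qed

lemma spectral_system_nonneg:
  fixes u :: "'u::dedekind_complete_riesz_space"
  shows "0 \<le> u \<Longrightarrow> 0 \<le> spectral_system u x t"
  unfolding spectral_system_def by (rule band_proj_nonneg)

lemma spectral_system_le:
  fixes u :: "'u::dedekind_complete_riesz_space"
  shows "spectral_system u x t \<le> u"
  unfolding spectral_system_def by (rule band_proj_le)

lemma spectral_system_mono:
  fixes u :: "'u::dedekind_complete_riesz_space"
  assumes "0 \<le> u" "s \<le> t"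
  shows "spectral_system u x s \<le> spectral_system u x t"
  unfolding spectral_system_def
  by (intro band_proj_mono pprt_mono diff_right_mono scaleR_right_mono assms)

text \<open>A gap \<open>y\<close> left by all the components lies where \<open>x\<close> is at
  least \<open>m\<close>, for every \<open>m\<close>: it is disjoint from
  \<open>pprt (m u - x)\<close>, so \<open>m y \<le> x\<close>, and the Archimedean property
  applies.\<close>

lemma has_sup_spectral_system:
  fixes u x :: "'u::dedekind_complete_riesz_space"
  assumes u: "0 \<le> u" and x: "0 \<le> x"
  shows "has_sup (range (\<lambda>m::nat. spectral_system u x (real m))) u"
proof (rule has_supI)
  show "a \<le> u" if "a \<in> range (\<lambda>m::nat. spectral_system u x (real m))" for a
    using that spectral_system_le by blast
  fix w assume w: "\<And>a. a \<in> range (\<lambda>m::nat. spectral_system u x (real m)) \<Longrightarrow> a \<le> w"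
  define y where "y = u - inf w u"
  have y0: "0 \<le> y" and yu: "y \<le> u"
  proof -
    show "0 \<le> y" unfolding y_def by (simp only: diff_ge_0_iff_ge inf_le2)
    have "0 \<le> spectral_system u x (real 0)" by (rule spectral_system_nonneg[OF u])
    also have "\<dots> \<le> w" by (rule w) (rule rangeI)
    finally have "0 \<le> inf w u" using u by simp
    then show "y \<le> u" by (simp add: y_def)
  qed
  have "real m *\<^sub>R y \<le> x" for m :: nat
  proof -
    let ?v = "pprt (real m *\<^sub>R u - x)"
    have "spectral_system u x (real m) \<le> inf w u"
      using w spectral_system_le[of u x "real m"] by simp
    then have "y \<le> u - band_proj ?v u"
      unfolding y_def spectral_system_def by (rule diff_left_mono)
    moreover have "inf ?v (u - band_proj ?v u) = 0"
      by (rule diff_band_proj_disjoint) (simp_all add: u)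
    ultimately have "inf ?v y = 0" by (intro inf_eq_0_mono[OF _ _ order_refl y0]) simp_all
    then have vy: "inf ?v (real m *\<^sub>R y) = 0" by (intro inf_scaleR_nat_eq_0 y0) simp_all
    have my: "0 \<le> real m *\<^sub>R y" using y0 by (intro scaleR_nonneg_nonneg) simp_all
    have "real m *\<^sub>R y \<le> real m *\<^sub>R u" using yu by (rule scaleR_left_mono) simp
    also have "\<dots> \<le> x + ?v" by (rule le_add_pprt_diff)
    finally have "real m *\<^sub>R y = inf (x + ?v) (real m *\<^sub>R y)" by (simp only: inf_absorb2)
    also have "\<dots> \<le> inf x (real m *\<^sub>R y) + inf ?v (real m *\<^sub>R y)"
      by (intro inf_add_le x my) simp
    also have "\<dots> \<le> x" by (simp add: vy)
    finally show ?thesis .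
  qed
  then have "y \<le> 0" by (rule riesz_archimedean)
  then have "u \<le> inf w u" by (simp add: y_def)
  then show "u \<le> w" by simp
qed simp

section \<open>Lower Riemann-Stieltjes sums and their images\<close>

lemma partition_nonneg:
  fixes t :: "nat \<Rightarrow> real"
  assumes "0 \<le> t 0" "\<forall>i<n. t i < t (Suc i)" "i \<le> n"
  shows "0 \<le> t i"
  using assms(3)
proof (induction i)
  case (Suc i)
  then have "0 \<le> t i" "t i < t (Suc i)" using assms(2) by simp_all
  then show ?case by simp
qed (rule assms(1))

lemma lower_sums_nonneg:
  fixes u :: "'u::dedekind_complete_riesz_space"
  assumes u: "0 \<le> u" and f: "\<And>s. 0 \<le> s \<Longrightarrow> 0 \<le> f s" and b: "b \<in> lower_sums u f x"
  shows "0 \<le> b"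
proof -
  obtain n t where t: "0 \<le> t 0" "\<forall>i<n. t i < t (Suc i)"
    and b_eq: "b = (\<Sum>i<n. Inf (f ` {t i..<t (Suc i)}) *\<^sub>R
              (spectral_system u x (t (Suc i)) - spectral_system u x (t i)))"
    using b unfolding lower_sums_def by blast
  note t0 = partition_nonneg[OF t]
  show ?thesis
    unfolding b_eq
  proof (intro sum_nonneg scaleR_nonneg_nonneg)
    fix i assume "i \<in> {..<n}"
    then have i: "0 \<le> t i" "t i < t (Suc i)" using t0[of i] t(2) by simp_all
    show "0 \<le> Inf (f ` {t i..<t (Suc i)})"
      using i by (intro cInf_greatest) (auto intro: f)
    show "0 \<le> spectral_system u x (t (Suc i)) - spectral_system u x (t i)"
      using spectral_system_mono[OF u, of "t i" "t (Suc i)" x] i(2) by simp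
  qed
qed

lemma zero_in_lower_sums: "0 \<in> lower_sums u f x"
  unfolding lower_sums_def by (intro CollectI exI[of _ "0::nat"] exI[of _ "\<lambda>_. 0::real"]) simp

text \<open>Below level \<open>m\<close> a lower sum of a monotone function \<open>f\<close> is at most \<open>f m\<close>, so the spectral
  components exhaust the unit in the sense of \<open>bdd_above_by_exhaustion\<close>.\<close>

lemma bdd_above_lower_sums:
  fixes u x :: "'u::dedekind_complete_riesz_space"
  assumes lc: "laterally_complete TYPE('u)" and wu: "weak_order_unit u" and x: "0 \<le> x"
    and f0: "\<And>s. 0 \<le> s \<Longrightarrow> 0 \<le> f s" and f_mono: "\<And>s t. 0 \<le> s \<Longrightarrow> s \<le> t \<Longrightarrow> f s \<le> f t"
  shows "bdd_above (lower_sums u f x)"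
proof -
  have u: "0 \<le> u" using wu by (simp add: weak_order_unit_def)
  let ?\<sigma> = "spectral_system u x"
  let ?c = "\<lambda>m::nat. ?\<sigma> (real m)"
  have comp: "inf (?c m) (u - ?c m) = 0" for m
    unfolding spectral_system_def by (rule band_proj_component) (simp_all add: u)
  have bd: "\<exists>r\<ge>0. b \<le> f (real m) *\<^sub>R u + r \<and> inf r (?c m) = 0"
    if "b \<in> lower_sums u f x" for b m
  proof -
    obtain n t where t: "0 \<le> t 0" "\<forall>i<n. t i < t (Suc i)"
      and b_eq: "b = (\<Sum>i<n. Inf (f ` {t i..<t (Suc i)}) *\<^sub>R (?\<sigma> (t (Suc i)) - ?\<sigma> (t i)))"
      using \<open>b \<in> lower_sums u f x\<close> unfolding lower_sums_def by blast
    note t0 = partition_nonneg[OF t]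
    define k where "k i = Inf (f ` {t i..<t (Suc i)})" for i
    have um: "0 \<le> u - ?c m" using spectral_system_le[of u x "real m"] by simp
    have k: "0 \<le> k i" "k i \<le> f (t i)" if "i < n" for i
    proof -
      have i: "0 \<le> t i" "t i < t (Suc i)" using t0[of i] t(2) that by simp_all
      show "0 \<le> k i" unfolding k_def using i by (intro cInf_greatest) (auto intro: f0)
      have "bdd_below (f ` {t i..<t (Suc i)})" using i by (intro bdd_belowI[of _ 0]) (auto intro: f0)
      then show "k i \<le> f (t i)" unfolding k_def using i by (intro cInf_lower) auto
    qed
    \<comment> \<open>The coefficient is at most the value of \<open>f\<close> at the left end. A
      cell starting at or below \<open>m\<close>, even one straddling \<open>m\<close>, thus gets at
      most \<open>f m\<close>; a cell starting above \<open>m\<close> lies in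
      \<open>u - ?c m\<close>.\<close>
    have term_le: "k i *\<^sub>R (?\<sigma> (t (Suc i)) - ?\<sigma> (t i))
        \<le> f (real m) *\<^sub>R (?\<sigma> (t (Suc i)) - ?\<sigma> (t i)) + k i *\<^sub>R (u - ?c m)" if i: "i < n" for i
    proof -
      have d0: "0 \<le> ?\<sigma> (t (Suc i)) - ?\<sigma> (t i)"
        using spectral_system_mono[OF u, of "t i" "t (Suc i)" x] t(2)[rule_format, OF i] by simp
      have p1: "0 \<le> f (real m) *\<^sub>R (?\<sigma> (t (Suc i)) - ?\<sigma> (t i))"
        using d0 by (intro scaleR_nonneg_nonneg f0) simp_all
      have p2: "0 \<le> k i *\<^sub>R (u - ?c m)" using um k(1)[OF i] by (intro scaleR_nonneg_nonneg)
      show ?thesis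
      proof (cases "t i \<le> real m")
        case True
        then have "k i \<le> f (real m)" using k(2)[OF i] f_mono[of "t i" "real m"] t0[of i] i by simp
        then have "k i *\<^sub>R (?\<sigma> (t (Suc i)) - ?\<sigma> (t i)) \<le> f (real m) *\<^sub>R (?\<sigma> (t (Suc i)) - ?\<sigma> (t i))"
          using d0 by (rule scaleR_right_mono)
        from add_mono[OF this p2] show ?thesis by simp
      next
        case False
        then have "?c m \<le> ?\<sigma> (t i)" by (intro spectral_system_mono[OF u]) simp
        with spectral_system_le have "?\<sigma> (t (Suc i)) - ?\<sigma> (t i) \<le> u - ?c m" by (rule diff_mono)
        then have "k i *\<^sub>R (?\<sigma> (t (Suc i)) - ?\<sigma> (t i)) \<le> k i *\<^sub>R (u - ?c m)"
          using k(1)[OF i] by (rule scaleR_left_mono)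
        from add_mono[OF p1 this] show ?thesis by simp
      qed
    qed
    \<comment> \<open>A crude remainder suffices: only its disjointness from \<open>?c m\<close>
      counts, not its size.\<close>
    let ?r = "(\<Sum>i<n. k i) *\<^sub>R (u - ?c m)"
    have k_sum: "0 \<le> (\<Sum>i<n. k i)" using k(1) by (intro sum_nonneg) simp
    have "b \<le> (\<Sum>i<n. f (real m) *\<^sub>R (?\<sigma> (t (Suc i)) - ?\<sigma> (t i)) + k i *\<^sub>R (u - ?c m))"
      unfolding b_eq k_def[symmetric] using term_le by (intro sum_mono) simp
    also have "\<dots> = f (real m) *\<^sub>R (\<Sum>i<n. ?\<sigma> (t (Suc i)) - ?\<sigma> (t i)) + ?r"
      by (simp only: sum.distrib scaleR_sum_right scaleR_sum_left)
    also have "(\<Sum>i<n. ?\<sigma> (t (Suc i)) - ?\<sigma> (t i)) = ?\<sigma> (t n) - ?\<sigma> (t 0)"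
      by (rule sum_lessThan_telescope)
    also have "f (real m) *\<^sub>R (?\<sigma> (t n) - ?\<sigma> (t 0)) + ?r \<le> f (real m) *\<^sub>R u + ?r"
    proof (intro add_right_mono scaleR_left_mono f0)
      show "?\<sigma> (t n) - ?\<sigma> (t 0) \<le> u"
        using diff_mono[OF spectral_system_le spectral_system_nonneg[OF u], of u x "t n" x "t 0"] by simp
    qed simp
    finally have "b \<le> f (real m) *\<^sub>R u + ?r" .
    moreover have "inf (?c m) ?r = 0"
      by (intro inf_scaleR_eq_0 comp spectral_system_nonneg[OF u] um k_sum)
    then have "inf ?r (?c m) = 0" by (simp only: inf_commute)
    moreover have "0 \<le> ?r" using k_sum um by (rule scaleR_nonneg_nonneg)
    ultimately show ?thesis by blast
  qed
  show ?thesis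
  proof (rule bdd_above_by_exhaustion[OF lc wu, where u = "\<lambda>m. f (real m) *\<^sub>R u"])
    show "mono ?c" by (intro monoI spectral_system_mono[OF u]) simp
    show "0 \<le> f (real m) *\<^sub>R u" for m using u by (intro scaleR_nonneg_nonneg f0) simp_all
    show "0 \<le> b" if "b \<in> lower_sums u f x" for b
      by (rule lower_sums_nonneg[OF u _ that]) (rule f0)
  qed (fact spectral_system_nonneg[OF u] comp has_sup_spectral_system[OF u x] bd)+
qed

text \<open>A band projection is made of infima, multiples and one supremum. Preservation of suprema
  is a premise so that both \<open>j\<close> and \<open>S\<close> qualify.\<close>

lemma band_proj_hom:
  assumes h: "riesz_hom F" and sup: "\<And>A s. has_sup A s \<Longrightarrow> has_sup (F ` A) (F s)"
  shows "F (band_proj v w) = band_proj (F v) (F w)"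
proof -
  have "has_sup (range (\<lambda>n::nat. inf (F w) (real n *\<^sub>R F v))) (F (band_proj v w))"
    using sup[OF band_proj_has_sup[of w v]]
    by (simp add: image_image riesz_hom_inf[OF h] linear_scale[OF riesz_hom_linear[OF h]])
  then show ?thesis by (rule has_sup_unique[OF _ band_proj_has_sup])
qed

text \<open>Used with the same \<open>w\<close> for \<open>j\<close> and for \<open>j\<close> after
  \<open>S\<close>, to pull both sets of lower sums back to one set.\<close>

lemma lower_sums_image:
  assumes F: "linear F" and w: "\<And>t. 0 \<le> t \<Longrightarrow> F (w t) = spectral_system u x t"
  shows "lower_sums u f x = F ` {\<Sum>i<n. Inf (f ` {t i..<t (Suc i)}) *\<^sub>R (w (t (Suc i)) - w (t i))
    | (n::nat) t. 0 \<le> t 0 \<and> (\<forall>i<n. t i < t (Suc i))}"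
proof -
  have eq: "F (\<Sum>i<n. Inf (f ` {t i..<t (Suc i)}) *\<^sub>R (w (t (Suc i)) - w (t i)))
      = (\<Sum>i<n. Inf (f ` {t i..<t (Suc i)}) *\<^sub>R
              (spectral_system u x (t (Suc i)) - spectral_system u x (t i)))"
    if t: "0 \<le> t 0" "\<forall>i<n. t i < t (Suc i)" for n :: nat and t
  proof -
    note t0 = partition_nonneg[OF t]
    show ?thesis
      unfolding linear_sum[OF F] linear_scale[OF F] linear_diff[OF F]
      by (intro sum.cong refl) (simp add: w t0)
  qed
  show ?thesis
  proof (intro subset_antisym subsetI)
    fix b assume "b \<in> lower_sums u f x"
    then obtain n t where t: "0 \<le> t 0" "\<forall>i<n. t i < t (Suc i)"
      and b: "b = (\<Sum>i<n. Inf (f ` {t i..<t (Suc i)}) *\<^sub>R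
              (spectral_system u x (t (Suc i)) - spectral_system u x (t i)))"
      unfolding lower_sums_def by blast
    show "b \<in> F ` {\<Sum>i<n. Inf (f ` {t i..<t (Suc i)}) *\<^sub>R (w (t (Suc i)) - w (t i))
        | (n::nat) t. 0 \<le> t 0 \<and> (\<forall>i<n. t i < t (Suc i))}"
      unfolding b eq[OF t, symmetric] using t by blast
  next
    fix b assume "b \<in> F ` {\<Sum>i<n. Inf (f ` {t i..<t (Suc i)}) *\<^sub>R (w (t (Suc i)) - w (t i))
        | (n::nat) t. 0 \<le> t 0 \<and> (\<forall>i<n. t i < t (Suc i))}"
    then obtain n t where t: "0 \<le> t 0" "\<forall>i<n. t i < t (Suc i)"
      and b: "b = F (\<Sum>i<n. Inf (f ` {t i..<t (Suc i)}) *\<^sub>R (w (t (Suc i)) - w (t i)))"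
      by blast
    show "b \<in> lower_sums u f x"
      unfolding b eq[OF t] lower_sums_def using t by blast
  qed
qed

section \<open>Conditional expectation preserving systems\<close>

locale cep_system = universal_completion_embedding j
  for j :: "'a::dedekind_complete_riesz_space \<Rightarrow> 'u::dedekind_complete_riesz_space" +
  fixes T S :: "'a \<Rightarrow> 'a" and e :: 'a
  assumes sys: "conditional_expectation_preserving_system T S e"
begin

lemma T_linear: "linear T"
  and T_strict: "0 < x \<Longrightarrow> 0 < T x"
  and unit: "weak_order_unit e"
  and S_hom: "riesz_hom S"
  and S_unit: "S e = e"
  and TS: "T (S x) = T x"
  using sys by (simp_all add: conditional_expectation_preserving_system_def conditional_riesz_triple_def)

lemma e_nonneg: "0 \<le> e"
  using unit by (simp add: weak_order_unit_def)

lemma T_normal: "normal_operator T"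
  unfolding normal_operator_def
proof (intro conjI allI impI)
  show "order_continuous T"
    using sys by (simp add: conditional_expectation_preserving_system_def conditional_riesz_triple_def)
  show "0 \<le> T x" if "0 \<le> x" for x
  proof (cases "x = 0")
    case True
    then show ?thesis by (simp add: linear_0[OF T_linear])
  next
    case False
    with that show ?thesis by (intro less_imp_le T_strict) simp
  qed
qed (rule T_linear)

lemma S_normal: "normal_operator S"
  using sys riesz_hom_nonneg[OF S_hom] riesz_hom_linear[OF S_hom]
  by (simp add: normal_operator_def conditional_expectation_preserving_system_def)

lemmas S_has_sup = normal_riesz_hom_has_sup[OF S_hom S_normal]

lemma j_unit: "weak_order_unit (j e)"
  unfolding weak_order_unit_def
proof (intro conjI allI impI)
  show "0 \<le> j e" by (rule j_nonneg[OF e_nonneg])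
  fix x :: 'u assume x: "inf \<bar>x\<bar> (j e) = 0"
  show "x = 0"
  proof (rule ccontr)
    assume "x \<noteq> 0"
    then have "0 < \<bar>x\<bar>" by simp
    then obtain y where y: "0 < y" "j y \<le> \<bar>x\<bar>" using dense by blast
    have "inf (j y) (j e) = 0"
      using y e_nonneg by (intro inf_eq_0_mono[OF x]) (simp_all add: j_nonneg)
    then have "j (inf y e) = j 0" by (simp add: j_inf j_0)
    then have "inf y e = 0" by (simp only: j_eq_iff)
    then have "inf \<bar>y\<bar> e = 0" using y(1) by simp
    then have "y = 0" using unit unfolding weak_order_unit_def by blast
    with y(1) show False by simp
  qed
qed

text \<open>If \<open>A\<close> were unbounded, the components \<open>P m\<close> of \<open>e\<close> on which some element of \<open>A\<close> exceeds
  \<open>m e\<close> would not decrease to \<open>0\<close>; but \<open>m T (P m)\<close> stays below the bound for \<open>T ` A\<close>, so this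
  contradicts strict positivity of \<open>T\<close>.\<close>

lemma bdd_above_of_T:
  assumes A: "up_directed A" and A0: "\<And>a. a \<in> A \<Longrightarrow> 0 \<le> a" and bdd: "bdd_above (j ` T ` A)"
  shows "bdd_above (j ` A)"
proof -
  have ne: "A \<noteq> {}" using A by (simp add: up_directed_def)
  \<comment> \<open>For functions, the indicator of \<open>{a > m}\<close>.\<close>
  define \<pi> where "\<pi> m a = band_proj (pprt (a - real m *\<^sub>R e)) e" for m :: nat and a
  define P where "P m = Sup (\<pi> m ` A)" for m
  have \<pi>0: "0 \<le> \<pi> m a" and \<pi>e: "\<pi> m a \<le> e" for m a
    unfolding \<pi>_def by (rule band_proj_nonneg[OF e_nonneg], rule band_proj_le)
  have \<pi>_mono: "\<pi> m a \<le> \<pi> m b" if "a \<le> b" for m a b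
    unfolding \<pi>_def by (intro band_proj_mono pprt_mono diff_right_mono that)
  have P: "has_sup (\<pi> m ` A) (P m)" for m
    unfolding P_def using ne \<pi>e by (intro has_sup_Sup bdd_aboveI[of _ e]) auto
  \<comment> \<open>Directedness matters because \<open>T\<close>, unlike \<open>S\<close>, need not
    preserve finite suprema.\<close>
  have dir: "up_directed (\<pi> m ` A)" for m
    unfolding up_directed_def
  proof (intro conjI ballI)
    fix p r assume "p \<in> \<pi> m ` A" "r \<in> \<pi> m ` A"
    then obtain a b where ab: "a \<in> A" "b \<in> A" "p = \<pi> m a" "r = \<pi> m b" by blast
    with A obtain c where c: "c \<in> A" "a \<le> c" "b \<le> c" unfolding up_directed_def by blast
    then show "\<exists>q\<in>\<pi> m ` A. p \<le> q \<and> r \<le> q"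
      unfolding ab(3,4) by (intro bexI[of _ "\<pi> m c"] conjI \<pi>_mono) simp_all
  qed (use ne in simp)
  have Pe: "P m \<le> e" for m by (rule has_sup_least[OF P]) (use \<pi>e in blast)
  have P0: "0 \<le> P m" for m
  proof -
    obtain a where "a \<in> A" using ne by blast
    then have "\<pi> m a \<le> P m" by (intro has_sup_upper[OF P]) simp
    with \<pi>0 show ?thesis by (rule order_trans)
  qed
  have P_anti: "P n \<le> P m" if "m \<le> n" for m n
  proof (rule has_sup_least[OF P])
    fix p assume "p \<in> \<pi> n ` A"
    then obtain a where a: "a \<in> A" "p = \<pi> n a" by blast
    have "p \<le> \<pi> m a" unfolding a(2) \<pi>_def
      by (intro band_proj_mono pprt_mono diff_left_mono scaleR_right_mono e_nonneg) (simp add: that)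
    also have "\<dots> \<le> P m" using a(1) by (intro has_sup_upper[OF P]) simp
    finally show "p \<le> P m" .
  qed
  have disj: "inf (P m) (e - P m) = 0" for m
  proof (rule has_sup_inf_eq_0[OF P])
    fix p assume p: "p \<in> \<pi> m ` A"
    then obtain a where a: "a \<in> A" "p = \<pi> m a" by blast
    have comp: "inf (\<pi> m a) (e - \<pi> m a) = 0"
      unfolding \<pi>_def by (rule band_proj_component) (simp_all add: e_nonneg)
    have le: "e - P m \<le> e - \<pi> m a"
      using has_sup_upper[OF P p] unfolding a(2) by (rule diff_left_mono)
    have "0 \<le> e - P m" using Pe[of m] by simp
    from inf_eq_0_mono[OF comp \<pi>0 order_refl this le]
    show "inf p (e - P m) = 0" by (simp only: a(2))
  qed
  obtain b where b: "\<And>a. a \<in> A \<Longrightarrow> j (T a) \<le> b" using bdd by (auto simp: bdd_above_def)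
  have b0: "0 \<le> b"
  proof -
    obtain a where a: "a \<in> A" using ne by blast
    have "0 \<le> j (T a)" by (intro j_nonneg normal_operator_nonneg[OF T_normal] A0 a)
    then show ?thesis using b[OF a] by (rule order_trans)
  qed
  \<comment> \<open>Markov's inequality for each \<open>a\<close>, passed to the directed supremum
    by order continuity of \<open>T\<close>.\<close>
  have TP: "real m *\<^sub>R j (T (P m)) \<le> b" for m
  proof (cases "m = 0")
    case True
    then show ?thesis using b0 by simp
  next
    case False
    have "has_sup (j ` T ` \<pi> m ` A) (j (T (P m)))"
      unfolding has_sup_j_iff by (rule normal_operator_has_sup[OF T_normal dir P])
    then have "has_sup ((\<lambda>x. real m *\<^sub>R x) ` j ` T ` \<pi> m ` A) (real m *\<^sub>R j (T (P m)))"
      using False by (intro has_sup_scaleR) simp_all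
    then show ?thesis
    proof (rule has_sup_least)
      fix y assume "y \<in> (\<lambda>x. real m *\<^sub>R x) ` j ` T ` \<pi> m ` A"
      then obtain a where a: "a \<in> A" "y = real m *\<^sub>R j (T (\<pi> m a))" by blast
      have "y = j (T (real m *\<^sub>R \<pi> m a))"
        unfolding a(2) by (simp only: linear_scale[OF T_linear] j_scaleR)
      also have "\<dots> \<le> j (T a)"
        unfolding \<pi>_def
        by (intro j_mono normal_operator_mono[OF T_normal] scaleR_band_proj_le A0 a(1) e_nonneg) simp
      also have "\<dots> \<le> b" by (rule b[OF a(1)])
      finally show "y \<le> b" .
    qed
  qed
  \<comment> \<open>The multiples of \<open>T ?p\<close> stay below \<open>b\<close>, so
    \<open>T ?p\<close> vanishes and strict positivity forces \<open>?p = 0\<close>.\<close>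
  have P_inf: "w \<le> 0" if w: "\<And>m. w \<le> P m" for w
  proof -
    let ?p = "pprt w"
    have p0: "0 \<le> ?p" by simp
    have pP: "?p \<le> P m" for m unfolding pprt_def by (intro le_supI w P0)
    have "real m *\<^sub>R j (T ?p) \<le> b" for m
    proof -
      have "real m *\<^sub>R j (T ?p) \<le> real m *\<^sub>R j (T (P m))"
        by (intro scaleR_left_mono j_mono normal_operator_mono[OF T_normal] pP) simp
      also have "\<dots> \<le> b" by (rule TP)
      finally show ?thesis .
    qed
    then have "j (T ?p) \<le> 0" by (rule riesz_archimedean)
    then have "T ?p \<le> 0" using j_le_iff[of "T ?p" 0] by (simp only: j_0)
    then have "\<not> 0 < ?p" using T_strict[of ?p] by (meson less_le_not_le)
    then have "?p = 0" using p0 by (simp add: less_le)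
    then show ?thesis by (simp only: le_zero_iff_zero_pprt)
  qed
  \<comment> \<open>The complements \<open>e - P m\<close> exhaust the unit; on each of them all
    elements of \<open>A\<close> are at most \<open>m e\<close>, the excess \<open>?r\<close> being
    disjoint from it.\<close>
  show ?thesis
  proof (rule bdd_above_by_exhaustion[OF lateral j_unit])
    fix m :: nat
    show "0 \<le> j (e - P m)" using Pe[of m] by (intro j_nonneg) simp
    show "0 \<le> j (real m *\<^sub>R e)" by (intro j_nonneg scaleR_nonneg_nonneg e_nonneg) simp
    have "inf (e - P m) (e - (e - P m)) = 0" using disj[of m] by (simp add: inf_commute)
    then show "inf (j (e - P m)) (j e - j (e - P m)) = 0"
      by (simp only: j_diff[symmetric] j_inf[symmetric] j_0)
    fix v assume "v \<in> j ` A"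
    then obtain a where a: "a \<in> A" "v = j a" by blast
    let ?r = "pprt (a - real m *\<^sub>R e)"
    have disj_r: "inf ?r (e - \<pi> m a) = 0"
      unfolding \<pi>_def by (rule diff_band_proj_disjoint) (simp_all add: e_nonneg)
    have le: "e - P m \<le> e - \<pi> m a"
      using a(1) by (intro diff_left_mono has_sup_upper[OF P]) simp
    have "0 \<le> e - P m" using Pe[of m] by simp
    from inf_eq_0_mono[OF disj_r zero_le_pprt order_refl this le]
    have "inf ?r (e - P m) = 0" .
    then have "inf (j ?r) (j (e - P m)) = 0" by (simp only: j_inf[symmetric] j_0)
    moreover have "v \<le> j (real m *\<^sub>R e) + j ?r"
      unfolding a(2) j_add[symmetric] by (intro j_mono le_add_pprt_diff)
    moreover have "0 \<le> j ?r" by (intro j_nonneg) simp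
    ultimately show "\<exists>r\<ge>0. v \<le> j (real m *\<^sub>R e) + r \<and> inf r (j (e - P m)) = 0" by blast
  next
    show "mono (\<lambda>m. j (e - P m))" by (intro monoI j_mono diff_left_mono P_anti)
    have "has_sup (range (\<lambda>m. e - P m)) e"
    proof (rule has_supI)
      show "a \<le> e" if "a \<in> range (\<lambda>m. e - P m)" for a using that P0 by auto
      fix u assume u: "\<And>a. a \<in> range (\<lambda>m. e - P m) \<Longrightarrow> a \<le> u"
      have "e - u \<le> P m" for m
      proof -
        have "e - P m \<le> u" by (rule u) (rule rangeI)
        then show ?thesis by (simp only: diff_le_eq add.commute)
      qed
      then have "e - u \<le> 0" by (rule P_inf)
      then show "e \<le> u" by simp
    qed simp
    then have "has_sup (j ` range (\<lambda>m. e - P m)) (j e)" by (simp only: has_sup_j_iff)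
    then show "has_sup (range (\<lambda>m. j (e - P m))) (j e)" by (simp only: image_image)
  next
    fix v assume "v \<in> j ` A"
    then show "0 \<le> v" using A0 by (auto intro: j_nonneg)
  qed
qed

section \<open>The extensions of \<open>S\<close> and \<open>T\<close> on
  \<open>L1 j T\<close>\<close>

lemma increases_to_S:
  assumes x: "x \<in> ext_dom T"
  shows "x \<in> ext_dom S \<and> increases_to j (S ` lower_part x) (ext S x) \<and>
    bdd_above (j ` T ` S ` lower_part x)"
proof -
  let ?L = "lower_part x"
  have dir: "up_directed (S ` ?L)"
    unfolding up_directed_def
  proof (intro conjI ballI)
    show "S ` ?L \<noteq> {}" using up_directed_lower_part[OF ext_dom_nonneg[OF x]] by (simp add: up_directed_def)
    fix p r assume "p \<in> S ` ?L" "r \<in> S ` ?L"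
    then obtain a b where ab: "a \<in> ?L" "b \<in> ?L" "p = S a" "r = S b" by blast
    with up_directed_lower_part[OF ext_dom_nonneg[OF x]]
    obtain c where c: "c \<in> ?L" "a \<le> c" "b \<le> c" unfolding up_directed_def by blast
    then show "\<exists>q\<in>S ` ?L. p \<le> q \<and> r \<le> q"
      unfolding ab(3,4) by (intro bexI[of _ "S c"] conjI riesz_hom_mono[OF S_hom]) simp_all
  qed
  have S0: "0 \<le> a" if "a \<in> S ` ?L" for a
    using that riesz_hom_nonneg[OF S_hom] by (auto simp: lower_part_def)
  have bT: "bdd_above (j ` T ` S ` ?L)" using x by (simp add: image_image TS ext_dom_def)
  have "bdd_above (j ` S ` ?L)" by (rule bdd_above_of_T[OF dir S0 bT])
  then have "x \<in> ext_dom S" using ext_dom_nonneg[OF x] by (simp add: ext_dom_def)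
  then show ?thesis using dir S0 bT has_sup_ext by (simp add: increases_to_iff)
qed

text \<open>The image under \<open>S\<close> of the canonical net of \<open>x\<close> is a net for
  \<open>ext S x\<close>, and \<open>T\<close> takes the same values on both.\<close>

lemma T_ext_S:
  assumes x: "x \<in> ext_dom T"
  shows "ext S x \<in> ext_dom T \<and> ext T (ext S x) = ext T x"
proof -
  from increases_to_S[OF x] have inc: "increases_to j (S ` lower_part x) (ext S x)"
    "bdd_above (j ` T ` S ` lower_part x)" by simp_all
  have "has_sup (j ` T ` S ` lower_part x) (ext T (ext S x))"
    using ext_of_increases[OF T_normal inc] by simp
  then have "has_sup (j ` T ` lower_part x) (ext T (ext S x))" by (simp add: image_image TS)
  then have "ext T (ext S x) = ext T x" by (rule has_sup_unique[OF _ has_sup_ext[OF x]])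
  then show ?thesis using ext_of_increases[OF T_normal inc] by simp
qed

lemma ext_dom_add:
  assumes "x \<in> ext_dom T" "y \<in> ext_dom T"
  shows "x + y \<in> ext_dom T" "ext T (x + y) = ext T x + ext T y" "ext S (x + y) = ext S x + ext S y"
  using ext_add[OF T_linear assms] ext_add[OF riesz_hom_linear[OF S_hom], of x y]
    increases_to_S[OF assms(1)] increases_to_S[OF assms(2)] by simp_all

lemma ext_dom_0: "x \<in> ext_dom T \<Longrightarrow> 0 \<in> ext_dom T"
  by (rule ext_dom_solid[OF _ order_refl ext_dom_nonneg])

lemma L1_eq: "L1 j T = {x - y | x y. x \<in> ext_dom T \<and> y \<in> ext_dom T}"
  by (simp add: L1_def natural_cone_eq[OF T_normal])

text \<open>From \<open>x = a - b\<close> follows \<open>x \<le> a\<close>, and the domain is solid.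
  Hence \<open>extend_T\<close> and \<open>extend_S\<close> start from the same cone.\<close>

lemma L1_nonneg_iff: "x \<in> L1 j T \<and> 0 \<le> x \<longleftrightarrow> x \<in> ext_dom T"
proof
  assume x: "x \<in> L1 j T \<and> 0 \<le> x"
  then obtain a b where ab: "x = a - b" "a \<in> ext_dom T" "b \<in> ext_dom T" unfolding L1_eq by blast
  have "x \<le> a" using ext_dom_nonneg[OF ab(3)] unfolding ab(1) by simp
  then show "x \<in> ext_dom T" using x by (intro ext_dom_solid[OF ab(2)]) simp_all
next
  assume x: "x \<in> ext_dom T"
  have "x = x - 0" by simp
  then show "x \<in> L1 j T \<and> 0 \<le> x"
    unfolding L1_eq using x ext_dom_0[OF x] ext_dom_nonneg[OF x] by blast
qed

lemma extend_T_eq: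
  assumes "x \<in> ext_dom T"
  shows "extend_T j T x = ext T x"
proof -
  have add: "a + b \<in> ext_dom T \<and>
      cone_extension j T (a + b) = cone_extension j T a + cone_extension j T b"
    if "a \<in> ext_dom T" "b \<in> ext_dom T" for a b
    using that by (simp add: ext_dom_add cone_extension_eq[OF T_normal])
  have 0: "0 \<in> ext_dom T" by (rule ext_dom_0[OF assms])
  have "ext T 0 = 0" using ext_dom_add(2)[OF 0 0] by simp
  then have "linear_extension (ext_dom T) (cone_extension j T) (x - 0) = ext T x"
    using linear_extension_eq[OF add assms 0] by (simp add: cone_extension_eq[OF T_normal] assms 0)
  then show ?thesis by (simp add: extend_T_def natural_cone_eq[OF T_normal])
qed

lemma extend_S_eq:
  assumes "x \<in> ext_dom T" "y \<in> ext_dom T"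
  shows "extend_S j T S (x - y) = ext S x - ext S y"
proof -
  have cone: "cone_extension j S a = ext S a" if "a \<in> ext_dom T" for a
    using increases_to_S[OF that] by (intro cone_extension_eq[OF S_normal]) simp
  have add: "a + b \<in> ext_dom T \<and>
      cone_extension j S (a + b) = cone_extension j S a + cone_extension j S b"
    if "a \<in> ext_dom T" "b \<in> ext_dom T" for a b
    using that by (simp add: ext_dom_add cone)
  have "{x \<in> L1 j T. 0 \<le> x} = ext_dom T" by (simp only: L1_nonneg_iff) simp
  then show ?thesis
    using linear_extension_eq[OF add assms] by (simp add: extend_S_def cone assms)
qed

text \<open>\<open>ext S\<close> keeps the positive and negative parts of \<open>x\<close> disjoint,
  so their images are the positive and negative parts of the image.\<close>

lemma extend_S_abs:
  assumes x: "x \<in> L1 j T"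
  shows "\<bar>x\<bar> \<in> ext_dom T \<and> extend_S j T S x \<in> L1 j T \<and> \<bar>extend_S j T S x\<bar> = ext S \<bar>x\<bar>"
proof -
  obtain a b where ab: "x = a - b" "a \<in> ext_dom T" "b \<in> ext_dom T" using x unfolding L1_eq by blast
  have a0: "0 \<le> a" and b0: "0 \<le> b" using ab ext_dom_nonneg by simp_all
  let ?p = "pprt x" and ?n = "pprt (- x)"
  have p: "?p \<in> ext_dom T"
    using a0 b0 by (intro ext_dom_solid[OF ab(2)]) (simp_all add: ab(1) pprt_diff)
  have n: "?n \<in> ext_dom T"
    using a0 b0 by (intro ext_dom_solid[OF ab(3)]) (simp_all add: ab(1) pprt_diff)
  have x_eq: "x = ?p - ?n" using prts[of x] by (simp only: pprt_neg) simp
  have abs_eq: "\<bar>z\<bar> = pprt z + pprt (- z)" for z :: 'u by (simp add: abs_prts pprt_neg)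
  have S_ext: "extend_S j T S x = ext S ?p - ext S ?n"
    using extend_S_eq[OF p n] x_eq by simp
  have dp: "?p \<in> ext_dom S" and dn: "?n \<in> ext_dom S"
    using increases_to_S[OF p] increases_to_S[OF n] by simp_all
  \<comment> \<open>Disjointness under \<open>S\<close> passes to the suprema one argument at a
    time.\<close>
  have disj: "inf (ext S ?p) (ext S ?n) = 0"
  proof (rule has_sup_inf_eq_0[OF has_sup_ext[OF dp]])
    fix v assume "v \<in> j ` S ` lower_part ?p"
    then obtain c where c: "0 \<le> c" "j c \<le> ?p" "v = j (S c)" by (auto simp: lower_part_def)
    have "inf (ext S ?n) v = 0"
    proof (rule has_sup_inf_eq_0[OF has_sup_ext[OF dn]])
      fix w assume "w \<in> j ` S ` lower_part ?n"
      then obtain d where d: "0 \<le> d" "j d \<le> ?n" "w = j (S d)" by (auto simp: lower_part_def)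
      have "inf (j c) (j d) = 0"
        using c d by (intro inf_eq_0_mono[OF inf_pprt_neg[of x]]) (simp_all add: j_nonneg)
      then have "inf c d = 0" by (simp only: j_inf[symmetric] j_0[symmetric] j_eq_iff)
      then have "inf d c = 0" by (simp only: inf_commute)
      then show "inf w v = 0"
        unfolding c(3) d(3) j_inf[symmetric] riesz_hom_inf[OF S_hom, symmetric]
        by (simp add: linear_0[OF riesz_hom_linear[OF S_hom]] j_0)
    qed
    then show "inf v (ext S ?n) = 0" by (simp only: inf_commute)
  qed
  have "inf (ext S ?n) (ext S ?p) = 0" using disj by (simp only: inf_commute)
  then have "pprt (ext S ?p - ext S ?n) = ext S ?p" "pprt (- (ext S ?p - ext S ?n)) = ext S ?n"
    using disj by (simp_all add: pprt_diff)
  then have "\<bar>extend_S j T S x\<bar> = ext S ?p + ext S ?n" by (simp add: S_ext abs_eq)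
  also have "\<dots> = ext S (?p + ?n)" by (rule ext_dom_add(3)[OF p n, symmetric])
  finally have "\<bar>extend_S j T S x\<bar> = ext S \<bar>x\<bar>" by (simp add: abs_eq)
  moreover have "\<bar>x\<bar> \<in> ext_dom T" using ext_dom_add(1)[OF p n] by (simp add: abs_eq)
  moreover have "extend_S j T S x \<in> L1 j T"
    unfolding S_ext L1_eq using T_ext_S[OF p] T_ext_S[OF n] by blast
  ultimately show ?thesis by blast
qed

text \<open>Although \<open>z\<close> itself lies only in the universal completion, \<open>inf z (t e)\<close> comes from the Riesz
  space, hence so does the spectral system of \<open>z\<close>.\<close>

lemma spectral_system_S:
  assumes z: "z \<in> ext_dom T" and t: "0 \<le> t"
  shows "\<exists>w. j w = spectral_system (j e) z t \<and> j (S w) = spectral_system (j e) (ext S z) t"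
proof -
  have z0: "0 \<le> z" by (rule ext_dom_nonneg[OF z])
  have te: "0 \<le> j (t *\<^sub>R e)" by (intro j_nonneg scaleR_nonneg_nonneg t e_nonneg)
  have zS: "z \<in> ext_dom S" using increases_to_S[OF z] by simp
  obtain y where y: "inf z (j (t *\<^sub>R e)) = j y"
    using range_j_ideal[of "inf z (j (t *\<^sub>R e))" "t *\<^sub>R e"] z0 te by auto
  \<comment> \<open>Computing the supremum of \<open>j\<close> S \<open>?Y\<close> in two ways
    identifies \<open>j (S y)\<close> as the truncation of \<open>ext S z\<close>.\<close>
  let ?Y = "(\<lambda>a. inf a (t *\<^sub>R e)) ` lower_part z"
  have "has_sup (j ` ?Y) (j y)"
    using has_sup_inf[OF has_sup_lower_part[OF z0], of "j (t *\<^sub>R e)"]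
    by (simp add: image_image j_inf y)
  then have "has_sup (j ` S ` ?Y) (j (S y))" unfolding has_sup_j_iff by (rule S_has_sup)
  moreover have "has_sup (j ` S ` ?Y) (inf (ext S z) (j (t *\<^sub>R e)))"
    using has_sup_inf[OF has_sup_ext[OF zS], of "j (t *\<^sub>R e)"]
    by (simp add: image_image j_inf riesz_hom_inf[OF S_hom] linear_scale[OF riesz_hom_linear[OF S_hom]] S_unit)
  ultimately have Sy: "j (S y) = inf (ext S z) (j (t *\<^sub>R e))" by (rule has_sup_unique)
  \<comment> \<open>\<open>pprt (t e - z)\<close> is \<open>t e - inf z (t e)\<close>, which
    involves \<open>z\<close> only through its truncation.\<close>
  let ?v = "t *\<^sub>R e - y"
  have v: "j ?v = pprt (t *\<^sub>R j e - z)"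
    by (simp add: pprt_diff j_diff y[symmetric] j_scaleR)
  have Sv: "j (S ?v) = pprt (t *\<^sub>R j e - ext S z)"
    by (simp add: pprt_diff j_diff Sy j_scaleR linear_diff[OF riesz_hom_linear[OF S_hom]]
        linear_scale[OF riesz_hom_linear[OF S_hom]] S_unit)
  have "j (band_proj ?v e) = spectral_system (j e) z t"
    unfolding spectral_system_def v[symmetric]
    by (rule band_proj_hom[OF j_hom]) (simp only: has_sup_j_iff)
  moreover have "j (S (band_proj ?v e)) = spectral_system (j e) (ext S z) t"
  proof -
    have "S (band_proj ?v e) = band_proj (S ?v) e"
      using band_proj_hom[OF S_hom S_has_sup, of ?v e] by (simp only: S_unit)
    then have "j (S (band_proj ?v e)) = j (band_proj (S ?v) e)" by (simp only:)
    also have "\<dots> = band_proj (j (S ?v)) (j e)"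
      by (rule band_proj_hom[OF j_hom]) (simp only: has_sup_j_iff)
    finally show ?thesis unfolding spectral_system_def Sv .
  qed
  ultimately show ?thesis by blast
qed

text \<open>Preservation of arbitrary suprema is at hand for \<open>S\<close>, not for
  \<open>ext S\<close>. So the lower sums are pulled back to a set \<open>Y\<close> in the original
  space, and leastness of \<open>ext S ?p\<close> is tested on each \<open>a\<close> in the lower
  part of \<open>?p\<close>.\<close>

lemma riesz_powr_S:
  assumes z: "z \<in> ext_dom T" and q: "0 \<le> q" and p: "riesz_powr (j e) z q \<in> L1 j T"
  shows "riesz_powr (j e) z q \<in> ext_dom T
    \<and> riesz_powr (j e) (ext S z) q = ext S (riesz_powr (j e) z q)"
proof -
  let ?f = "\<lambda>s::real. s powr q" and ?p = "riesz_powr (j e) z q"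
  \<comment> \<open>One choice of \<open>w\<close> serves both \<open>z\<close> and
    \<open>ext S z\<close>.\<close>
  have "\<forall>t. \<exists>w. 0 \<le> t \<longrightarrow>
      j w = spectral_system (j e) z t \<and> j (S w) = spectral_system (j e) (ext S z) t"
    using spectral_system_S[OF z] by blast
  then obtain w where w: "\<And>t. 0 \<le> t \<Longrightarrow> j (w t) = spectral_system (j e) z t"
    "\<And>t. 0 \<le> t \<Longrightarrow> j (S (w t)) = spectral_system (j e) (ext S z) t" by metis
  define Y where "Y = {\<Sum>i<n. Inf (?f ` {t i..<t (Suc i)}) *\<^sub>R (w (t (Suc i)) - w (t i))
    | (n::nat) t. 0 \<le> t 0 \<and> (\<forall>i<n. t i < t (Suc i))}"
  have Y: "lower_sums (j e) ?f z = j ` Y"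
    unfolding Y_def by (rule lower_sums_image[OF j_linear w(1)])
  have "linear (\<lambda>a. j (S a))"
    using linear_compose[OF riesz_hom_linear[OF S_hom] j_linear] by (simp add: o_def)
  then have "lower_sums (j e) ?f (ext S z) = (\<lambda>a. j (S a)) ` Y"
    unfolding Y_def by (rule lower_sums_image) (rule w(2))
  then have SY: "lower_sums (j e) ?f (ext S z) = j ` S ` Y" by (simp add: image_image)
  \<comment> \<open>Only with this bound is the \<open>Sup\<close> defining the power a true
    supremum.\<close>
  have "bdd_above (lower_sums (j e) ?f z)"
    by (rule bdd_above_lower_sums[OF lateral j_unit ext_dom_nonneg[OF z]])
      (use q in \<open>auto intro: powr_mono2\<close>)
  then have "has_sup (lower_sums (j e) ?f z) ?p"
    unfolding riesz_powr_def functional_calculus_def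
    using zero_in_lower_sums[of "j e" ?f z] by (intro has_sup_Sup) auto
  then have s: "has_sup (j ` Y) ?p" by (simp only: Y)
  have "0 \<le> ?p" using zero_in_lower_sums[of "j e" ?f z] by (intro has_sup_upper[OF s]) (simp only: Y)
  with p have pT: "?p \<in> ext_dom T" using L1_nonneg_iff by blast
  then have pS: "?p \<in> ext_dom S" using increases_to_S by blast
  have "has_sup (j ` S ` Y) (ext S ?p)"
  proof (rule has_supI)
    show "j ` S ` Y \<noteq> {}" using has_sup_nonempty[OF s] by simp
    fix v assume "v \<in> j ` S ` Y"
    then obtain y where y: "y \<in> Y" "v = j (S y)" by blast
    have "j y \<in> lower_sums (j e) ?f z" using y(1) by (simp only: Y imageI)
    then have "0 \<le> j y" by (rule lower_sums_nonneg[rotated 2]) (simp_all add: j_nonneg e_nonneg)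
    then have "0 \<le> y" by (simp only: j_nonneg_iff)
    then show "v \<le> ext S ?p"
      unfolding y(2) using y(1) by (intro le_ext[OF pS] has_sup_upper[OF s]) simp_all
  next
    fix u assume u: "\<And>v. v \<in> j ` S ` Y \<Longrightarrow> v \<le> u"
    show "ext S ?p \<le> u"
    proof (rule has_sup_least[OF has_sup_ext[OF pS]])
      fix v assume "v \<in> j ` S ` lower_part ?p"
      then obtain a where a: "0 \<le> a" "j a \<le> ?p" "v = j (S a)" by (auto simp: lower_part_def)
      \<comment> \<open>Truncated at \<open>a\<close>, the set \<open>Y\<close> has supremum
        \<open>a\<close> inside the original space, where \<open>S_has_sup\<close> applies.\<close>
      let ?Z = "(\<lambda>y. inf y a) ` Y"
      have "has_sup (j ` ?Z) (j a)"
        using has_sup_inf[OF s, of "j a"] a(2) by (simp add: image_image j_inf inf_absorb2)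
      then have "has_sup (j ` S ` ?Z) (j (S a))" unfolding has_sup_j_iff by (rule S_has_sup)
      then show "v \<le> u"
        unfolding a(3)
      proof (rule has_sup_least)
        fix b assume "b \<in> j ` S ` ?Z"
        then obtain y where y: "y \<in> Y" "b = j (S (inf y a))" by blast
        have "b \<le> j (S y)" unfolding y(2) by (intro j_mono riesz_hom_mono[OF S_hom]) simp
        also have "\<dots> \<le> u" using y(1) by (intro u) simp
        finally show "b \<le> u" .
      qed
    qed
  qed
  then have "riesz_powr (j e) (ext S z) q = ext S ?p"
    unfolding riesz_powr_def[of _ "ext S z"] functional_calculus_def[of _ _ "ext S z"] SY
    by (rule Sup_eq_has_sup)
  with pT show ?thesis by blast
qed

end

theorem theorem11:
  fixes j :: "'a::dedekind_complete_riesz_space \<Rightarrow> 'u::dedekind_complete_riesz_space"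
    and T S :: "'a \<Rightarrow> 'a" and e :: 'a and q :: real
  assumes "universal_completion j"
    and "conditional_expectation_preserving_system T S e"
    and "1 \<le> q"
  shows "extend_S j T S ` Lq j T e q \<subseteq> Lq j T e q
    \<and> (\<forall>x \<in> Lq j T e q. Lq_norm j T e q (extend_S j T S x) = Lq_norm j T e q x)"
proof -
  interpret cep_system j T S e by unfold_locales (fact assms)+
  have "extend_S j T S x \<in> Lq j T e q \<and> Lq_norm j T e q (extend_S j T S x) = Lq_norm j T e q x"
    if "x \<in> Lq j T e q" for x
  proof -
    let ?p = "riesz_powr (j e) \<bar>x\<bar> q"
    have x: "x \<in> L1 j T" and p: "?p \<in> L1 j T" using that by (simp_all add: Lq_def)
    have z: "\<bar>x\<bar> \<in> ext_dom T" and Sx: "extend_S j T S x \<in> L1 j T"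
      and abs: "\<bar>extend_S j T S x\<bar> = ext S \<bar>x\<bar>" using extend_S_abs[OF x] by simp_all
    have pT: "?p \<in> ext_dom T" and Sp: "riesz_powr (j e) \<bar>extend_S j T S x\<bar> q = ext S ?p"
      using riesz_powr_S[OF z _ p] \<open>1 \<le> q\<close> by (simp_all add: abs)
    have "ext S ?p \<in> L1 j T" using T_ext_S[OF pT] L1_nonneg_iff by blast
    moreover have "extend_T j T (ext S ?p) = extend_T j T ?p"
      using T_ext_S[OF pT] by (simp add: extend_T_eq pT)
    ultimately show ?thesis by (simp add: Lq_def Lq_norm_def Sx Sp)
  qed
  then show ?thesis by blast
qed

end
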